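(* Consider the semi-clairvoyant algorithm P-FIRST: at any time $t$ with $n_t$ active jobs, if at least one active job is in a fully-parallel phase, it executes any one such job on all $P$ processors, each running at speed $\left(\frac{1}{(\alpha-1)P}\right)^{1/\alpha}$; otherwise it executes all active jobs on $P'=\min\{n_t,P\}$ processors, sharing the processors equally among the jobs, each processor running at speed $\left(\frac{1}{(\alpha-1)P'}\right)^{1/\alpha}$. Then P-FIRST is $O(\ln^{1-1/\alpha}P)$-competitive with respect to makespan plus energy for any set of batched PAR-SEQ jobs: there is a constant $C$ depending only on $\alpha$ such that for every $P\ge 2$ and every batched set $\mathcal{J}$ of PAR-SEQ jobs, $H_{\text{P-FIRST}}(\mathcal{J})\le C(\ln P)^{1-1/\alpha}H^*(\mathcal{J})$.
   Context: Model: there are $P$ processors whose speeds can be set individually at every time; a processor running at speed $s\ge 0$ consumes power $s^\alpha$, where $\alpha>1$ is a fixed constant. Each job $J_i$ consists of a sequence of phases executed in order; phase $J_i^k$ has work $w_i^k>0$ and parallelism $h_i^k\in[1,\infty]$. A phase is fully-parallel if $h_i^k=\infty$ and sequential if $h_i^k=1$; a PAR-SEQ job is one all of whose phases are sequential or fully-parallel. Batched: all jobs are released at time $0$. If at time $t$ job $J_i$ is in phase $k$ and is allocated $a_i(t)$ processors with speeds $s_1\ge\dots\ge s_{a_i(t)}$, its execution rate is $\sum_{j=1}^{\min\{a_i(t),h_i^k\}}s_j$. A valid schedule uses disjoint processor sets with $\sum_i a_i(t)\le P$, unallocated processors have speed $0$, phases run in order, and each job completes at finite time $c_i$; a job is active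 until it completes. Makespan $M=\max_i c_i$, energy $E=\int_0^\infty u_t\,dt$ with $u_t$ the total power at time $t$, $H=M+E$; $H_A$ is its value under algorithm $A$ and $H^*$ the minimum over all valid schedules. Semi-clairvoyant: the algorithm knows the current parallelism of each active job but not future parallelism or remaining work. *)

theory Defs
  imports "HOL-Analysis.Analysis"
begin

datatype phase = Phase (work: real) (parallelism: ereal)

type_synonym job = "phase list"

definition wf_job :: "job \<Rightarrow> bool" where
  "wf_job J \<longleftrightarrow> (\<forall>\<phi>\<in>set J. 0 < work \<phi> \<and> 1 \<le> parallelism \<phi>)"

definition par_seq :: "job \<Rightarrow> bool" where
  "par_seq J \<longleftrightarrow> (\<forall>\<phi>\<in>set J. parallelism \<phi> = 1 \<or> parallelism \<phi> = \<infinity>)"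


text \<open>
  The progress of a job is determined by its rate function \<open>\<rho>\<close>: \<open>\<rho> h t\<close> is the rate at which
  the job executes at time \<open>t\<close> if its current phase has parallelism \<open>h\<close>. The value
  \<open>phase_end \<rho> J k\<close> is the time at which the first \<open>k\<close> phases of \<open>J\<close> (released at time 0) are
  finished, namely the earliest time by which the rate, integrated from the end of the previous
  phase on, has accumulated to the work of the phase; it is infinite if this never happens.
\<close>

primrec phase_end :: "(ereal \<Rightarrow> real \<Rightarrow> real) \<Rightarrow> job \<Rightarrow> nat \<Rightarrow> ennreal" where
  "phase_end \<rho> J 0 = 0"
| "phase_end \<rho> J (Suc k) =
     Inf {\<tau>. phase_end \<rho> J k \<le> \<tau> \<and>
       ennreal (work (J ! k)) \<le>
         (\<integral>\<^sup>+ t \<in> {t. 0 \<le> t \<and> phase_end \<rho> J k \<le> ennreal t \<and> ennreal t \<le> \<tau>}.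
            ennreal (\<rho> (parallelism (J ! k)) t) \<partial>lborel)}"

definition completion :: "(ereal \<Rightarrow> real \<Rightarrow> real) \<Rightarrow> job \<Rightarrow> ennreal" where
  "completion \<rho> J = phase_end \<rho> J (length J)"

definition active :: "(ereal \<Rightarrow> real \<Rightarrow> real) \<Rightarrow> job \<Rightarrow> real \<Rightarrow> bool" where
  "active \<rho> J t \<longleftrightarrow> ennreal t < completion \<rho> J"

definition in_phase :: "(ereal \<Rightarrow> real \<Rightarrow> real) \<Rightarrow> job \<Rightarrow> nat \<Rightarrow> real \<Rightarrow> bool" where
  "in_phase \<rho> J k t \<longleftrightarrow>
     k < length J \<and> phase_end \<rho> J k \<le> ennreal t \<and> ennreal t < phase_end \<rho> J (Suc k)"

definition makespan :: "(nat \<Rightarrow> ereal \<Rightarrow> real \<Rightarrow> real) \<Rightarrow> job list \<Rightarrow> ennreal" where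
  "makespan \<rho> js = (SUP i\<in>{..<length js}. completion (\<rho> i) (js ! i))"

definition energy :: "(real \<Rightarrow> real) \<Rightarrow> ennreal" where
  "energy u = (\<integral>\<^sup>+ t \<in> {0..}. ennreal (u t) \<partial>lborel)"


text \<open>Schedules: \<open>procs \<sigma> i t\<close> is the set of processors (out of \<open>{..<P}\<close>) running job \<open>i\<close> at time
  \<open>t\<close>, and \<open>speed \<sigma> t p\<close> is the speed of processor \<open>p\<close> at time \<open>t\<close>.\<close>

record schedule =
  procs :: "nat \<Rightarrow> real \<Rightarrow> nat set"
  speed :: "real \<Rightarrow> nat \<Rightarrow> real"

definition speeds_desc :: "nat set \<Rightarrow> (nat \<Rightarrow> real) \<Rightarrow> real list" where
  "speeds_desc A v = rev (sort (map v (sorted_list_of_set A)))"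

definition exec_rate :: "ereal \<Rightarrow> nat set \<Rightarrow> (nat \<Rightarrow> real) \<Rightarrow> real" where
  "exec_rate h A v =
     (\<Sum>j\<in>{j. 1 \<le> j \<and> ereal (real j) \<le> min (ereal (real (card A))) h}. speeds_desc A v ! (j - 1))"

definition sched_rate :: "schedule \<Rightarrow> nat \<Rightarrow> ereal \<Rightarrow> real \<Rightarrow> real" where
  "sched_rate \<sigma> i h t = exec_rate h (procs \<sigma> i t) (speed \<sigma> t)"

definition sched_power :: "real \<Rightarrow> nat \<Rightarrow> schedule \<Rightarrow> real \<Rightarrow> real" where
  "sched_power \<alpha> P \<sigma> t = (\<Sum>p<P. speed \<sigma> t p powr \<alpha>)"

definition valid_schedule :: "nat \<Rightarrow> job list \<Rightarrow> schedule \<Rightarrow> bool" where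
  "valid_schedule P js \<sigma> \<longleftrightarrow>
     (\<forall>t\<ge>0. (\<forall>i<length js. procs \<sigma> i t \<subseteq> {..<P}) \<and>
        disjoint_family_on (\<lambda>i. procs \<sigma> i t) {..<length js} \<and>
        (\<forall>p<P. 0 \<le> speed \<sigma> t p) \<and>
        (\<forall>p<P. p \<notin> (\<Union>i<length js. procs \<sigma> i t) \<longrightarrow> speed \<sigma> t p = 0)) \<and>
     (\<forall>i<length js. \<forall>p<P. {t. p \<in> procs \<sigma> i t} \<in> sets borel) \<and>
     (\<forall>p<P. (\<lambda>t. speed \<sigma> t p) \<in> borel_measurable borel) \<and>
     (\<forall>i<length js. completion (sched_rate \<sigma> i) (js ! i) < \<infinity>)"

definition sched_cost :: "real \<Rightarrow> nat \<Rightarrow> job list \<Rightarrow> schedule \<Rightarrow> ennreal" where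
  "sched_cost \<alpha> P js \<sigma> = makespan (sched_rate \<sigma>) js + energy (sched_power \<alpha> P \<sigma>)"

definition opt_cost :: "real \<Rightarrow> nat \<Rightarrow> job list \<Rightarrow> ennreal" where
  "opt_cost \<alpha> P js = (INF \<sigma>\<in>{\<sigma>. valid_schedule P js \<sigma>}. sched_cost \<alpha> P js \<sigma>)"


text \<open>
  Equal sharing of \<open>P\<close> processors among more than \<open>P\<close> jobs is processor sharing: each job holds a
  fractional number of processors. In a shared execution job \<open>i\<close> holds \<open>a i t\<close> processors, all of
  them running at the common speed \<open>s t\<close>, so that the sum of the \<open>min {a, h}\<close> largest speeds is
  \<open>min a h * s\<close>.
\<close>

definition shared_rate ::
  "(nat \<Rightarrow> real \<Rightarrow> real) \<Rightarrow> (real \<Rightarrow> real) \<Rightarrow> nat \<Rightarrow> ereal \<Rightarrow> real \<Rightarrow> real" where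
  "shared_rate a s i h t = real_of_ereal (min (ereal (a i t)) h) * s t"

lemma exec_rate_equal_speeds:
  assumes "finite A" and "h = 1 \<or> h = \<infinity>"
  shows "exec_rate h A (\<lambda>_. s) = shared_rate (\<lambda>_ _. real (card A)) (\<lambda>_. s) i h t"
proof -
  let ?I = "{j::nat. 1 \<le> j \<and> ereal (real j) \<le> min (ereal (real (card A))) h}"
  have "speeds_desc A (\<lambda>_. s) = replicate (card A) s"
    using assms(1) by (simp add: speeds_desc_def map_replicate_const)
  moreover have "j - 1 < card A" if "j \<in> ?I" for j
    using that by auto
  ultimately have "exec_rate h A (\<lambda>_. s) = real (card ?I) * s"
    by (simp add: exec_rate_def)
  moreover have "real (card ?I) = real_of_ereal (min (ereal (real (card A))) h)"
    using assms(2)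
  proof
    assume h: "h = 1"
    have "?I = {1..min (card A) 1}"
      by (auto simp: h one_ereal_def)
    then show ?thesis
      by (simp add: h one_ereal_def min_def)
  next
    assume h: "h = \<infinity>"
    have "?I = {1..card A}"
      by (auto simp: h)
    then show ?thesis
      by (simp add: h)
  qed
  ultimately show ?thesis
    by (simp add: shared_rate_def)
qed

definition shared_power ::
  "real \<Rightarrow> nat \<Rightarrow> (nat \<Rightarrow> real \<Rightarrow> real) \<Rightarrow> (real \<Rightarrow> real) \<Rightarrow> real \<Rightarrow> real" where
  "shared_power \<alpha> n a s t = (\<Sum>i<n. a i t) * s t powr \<alpha>"

definition shared_cost ::
  "real \<Rightarrow> job list \<Rightarrow> (nat \<Rightarrow> real \<Rightarrow> real) \<Rightarrow> (real \<Rightarrow> real) \<Rightarrow> ennreal" where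
  "shared_cost \<alpha> js a s =
     makespan (shared_rate a s) js + energy (shared_power \<alpha> (length js) a s)"

definition active_jobs ::
  "job list \<Rightarrow> (nat \<Rightarrow> real \<Rightarrow> real) \<Rightarrow> (real \<Rightarrow> real) \<Rightarrow> real \<Rightarrow> nat set" where
  "active_jobs js a s t = {i. i < length js \<and> active (shared_rate a s i) (js ! i) t}"

definition parallel_jobs ::
  "job list \<Rightarrow> (nat \<Rightarrow> real \<Rightarrow> real) \<Rightarrow> (real \<Rightarrow> real) \<Rightarrow> real \<Rightarrow> nat set" where
  "parallel_jobs js a s t =
     {i \<in> active_jobs js a s t.
        \<exists>k. in_phase (shared_rate a s i) (js ! i) k t \<and> parallelism (js ! i ! k) = \<infinity>}"

definition p_first_speed :: "real \<Rightarrow> nat \<Rightarrow> real" where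
  "p_first_speed \<alpha> m = (1 / ((\<alpha> - 1) * real m)) powr (1 / \<alpha>)"

text \<open>
  \<open>p_first \<alpha> P js a s\<close> states that \<open>(a, s)\<close> is an execution of P-FIRST. The allocation at time
  \<open>t\<close> depends on the phases the jobs are in at time \<open>t\<close>, which in turn result from the execution
  itself. The executed fully-parallel job may be chosen arbitrarily (but measurably) at every time,
  so a job list has many executions.
\<close>

definition p_first ::
  "real \<Rightarrow> nat \<Rightarrow> job list \<Rightarrow> (nat \<Rightarrow> real \<Rightarrow> real) \<Rightarrow> (real \<Rightarrow> real) \<Rightarrow> bool" where
  "p_first \<alpha> P js a s \<longleftrightarrow>
     (\<forall>i<length js. a i \<in> borel_measurable borel) \<and> s \<in> borel_measurable borel \<and>
     (\<forall>t\<ge>0.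
        let A = active_jobs js a s t; F = parallel_jobs js a s t; P' = min (card A) P in
          if F \<noteq> {} then
            s t = p_first_speed \<alpha> P \<and>
            (\<exists>j\<in>F. \<forall>i<length js. a i t = (if i = j then real P else 0))
          else if A \<noteq> {} then
            s t = p_first_speed \<alpha> P' \<and>
            (\<forall>i<length js. a i t = (if i \<in> A then real P' / real (card A) else 0))
          else
            s t = 0 \<and> (\<forall>i<length js. a i t = 0))"

end

theory Submission
  imports Defs
begin

text \<open>
  P-FIRST draws power \<open>1 / (\<alpha> - 1)\<close> as long as some job is active, so its cost is
  \<open>\<alpha> / (\<alpha> - 1)\<close> times its makespan. All schedules are bounded from below by
  \<open>x \<le> c + c\<^bsup>1 - \<alpha>\<^esup> x\<^bsup>\<alpha>\<^esup>\<close>, which turns processing speed into time plus energy, with \<open>c\<close> at our disposal.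

  While P-FIRST executes a fully-parallel phase or more than \<open>P\<close> jobs, it works at total rate
  proportional to \<open>P\<^bsup>1 - 1/\<alpha>\<^esup>\<close>; taking \<open>c = P\<^bsup>-1/\<alpha>\<^esup>\<close>, the total work bounds this time by a
  constant times the optimum. Otherwise \<open>m \<le> P\<close> jobs run sequentially, each at speed proportional to
  \<open>m\<^bsup>-1/\<alpha>\<^esup>\<close>. Rank the jobs by decreasing completion time, so that the active ones are those of rank
  at most \<open>m\<close>. Because \<open>m\<^bsup>1/\<alpha>\<^esup> \<le> \<Sum>j\<le>m. j\<^bsup>1/\<alpha> - 1\<^esup>\<close>, the time spent in this mode is at most a
  constant times \<open>\<Sum>j\<le>P. j\<^bsup>1/\<alpha> - 1\<^esup> L\<^sub>j\<close>, where \<open>L\<^sub>j\<close> is the sequential work of the job of rank \<open>j\<close>.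
  Bounding \<open>L\<^sub>j\<close> with \<open>c = (j ln P)\<^bsup>-1/\<alpha>\<^esup>\<close> gives the weight \<open>(ln P)\<^bsup>1 - 1/\<alpha>\<^esup>\<close> to the energy of
  each job, and the weight \<open>(ln P)\<^bsup>-1/\<alpha>\<^esup> \<Sum>j\<le>P. 1/j\<close> to the makespan.
\<close>

section \<open>Phases\<close>

declare phase_end.simps(2) [simp del]

lemma phase_end_Suc_ge: "phase_end \<rho> J k \<le> phase_end \<rho> J (Suc k)"
  by (auto simp: phase_end.simps(2) intro!: Inf_greatest)

lemma phase_end_mono: "k \<le> l \<Longrightarrow> phase_end \<rho> J k \<le> phase_end \<rho> J l"
  by (rule lift_Suc_mono_le[of "phase_end \<rho> J"]) (auto simp: phase_end_Suc_ge)

text \<open>\<open>ennreal\<close> sends negative times to 0, so \<open>in_phase\<close> alone does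
  not keep them out; hence the condition \<open>0 \<le> t\<close>.\<close>

definition phase_time :: "(ereal \<Rightarrow> real \<Rightarrow> real) \<Rightarrow> job \<Rightarrow> nat \<Rightarrow> real set" where
  "phase_time \<rho> J k = {t. 0 \<le> t \<and> in_phase \<rho> J k t}"

lemma phase_time_borel [measurable]: "phase_time \<rho> J k \<in> sets borel"
  unfolding phase_time_def in_phase_def by measurable

lemma in_phase_unique:
  assumes "in_phase \<rho> J k t" "in_phase \<rho> J l t"
  shows "k = l"
proof (rule ccontr)
  assume "k \<noteq> l"
  then have "Suc k \<le> l \<or> Suc l \<le> k" by linarith
  then have "phase_end \<rho> J (Suc k) \<le> phase_end \<rho> J l \<or> phase_end \<rho> J (Suc l) \<le> phase_end \<rho> J k"
    using phase_end_mono by blast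
  with assms show False
    unfolding in_phase_def by (meson leD le_less_trans less_le_trans)
qed

lemma disjoint_phase_time: "disjoint_family_on (phase_time \<rho> J) K"
  using in_phase_unique by (fastforce simp: disjoint_family_on_def phase_time_def)

text \<open>The least \<open>l\<close> whose phase end lies beyond \<open>t\<close> is the successor
  of the current phase.\<close>

lemma active_iff_in_phase:
  assumes "0 \<le> t"
  shows "active \<rho> J t \<longleftrightarrow> (\<exists>k. in_phase \<rho> J k t)"
proof
  assume "active \<rho> J t"
  then have act: "ennreal t < phase_end \<rho> J (length J)"
    by (simp add: active_def completion_def)
  define l where "l = (LEAST l. ennreal t < phase_end \<rho> J l)"
  have l: "ennreal t < phase_end \<rho> J l"
    unfolding l_def by (rule LeastI) (rule act)
  have l_le: "l \<le> length J"
    unfolding l_def by (rule Least_le) (rule act)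
  have "l \<noteq> 0" using l by (cases l) auto
  then obtain k where k: "l = Suc k" by (cases l) auto
  then have "\<not> ennreal t < phase_end \<rho> J k"
    unfolding l_def using not_less_Least by (metis lessI)
  then have "in_phase \<rho> J k t"
    using l l_le k by (simp add: in_phase_def)
  then show "\<exists>k. in_phase \<rho> J k t" ..
next
  assume "\<exists>k. in_phase \<rho> J k t"
  then obtain k where "k < length J" "ennreal t < phase_end \<rho> J (Suc k)"
    by (auto simp: in_phase_def)
  then show "active \<rho> J t"
    unfolding active_def completion_def
    by (meson Suc_leI less_le_trans phase_end_mono)
qed

section \<open>Work of a phase versus its integrated rate\<close>

lemma nn_integral_eq_emeasure_density:
  fixes f :: "real \<Rightarrow> ennreal"
  assumes [measurable]: "f \<in> borel_measurable borel" "A \<in> sets borel"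
  shows "(\<integral>\<^sup>+t\<in>A. f t \<partial>lborel) = emeasure (density lborel f) A"
  by (simp add: emeasure_density)

text \<open>Before the end of a phase its work has not been accumulated, since that end is an
  infimum. The half-open phase interval is an increasing union of closed ones
  \<open>I (\<tau> n)\<close> with \<open>\<tau> n\<close> before the end, and continuity from below
  of the measure with the rate as density carries the bound over.\<close>

lemma rate_integral_le_work:
  assumes k: "k < length J"
    and [measurable]: "\<rho> (parallelism (J ! k)) \<in> borel_measurable borel"
  shows "(\<integral>\<^sup>+t\<in>phase_time \<rho> J k. ennreal (\<rho> (parallelism (J ! k)) t) \<partial>lborel) \<le> ennreal (work (J ! k))"
proof (cases "phase_end \<rho> J k < phase_end \<rho> J (Suc k)")
  case False
  then have "phase_time \<rho> J k = {}"
    unfolding phase_time_def in_phase_def using le_less_trans by blast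
  then show ?thesis by simp
next
  case True
  let ?b = "phase_end \<rho> J k" and ?e = "phase_end \<rho> J (Suc k)"
  define f where "f t = ennreal (\<rho> (parallelism (J ! k)) t)" for t
  have [measurable]: "f \<in> borel_measurable borel" unfolding f_def by measurable
  define I where "I \<tau> = {t. 0 \<le> t \<and> ?b \<le> ennreal t \<and> ennreal t \<le> \<tau>}" for \<tau>
  have [measurable]: "I \<tau> \<in> sets borel" for \<tau> unfolding I_def by measurable
  have Sup: "Sup {?b..<?e} = ?e" using True by simp
  obtain \<tau> :: "nat \<Rightarrow> ennreal" where \<tau>: "incseq \<tau>" "range \<tau> \<subseteq> {?b..<?e}" "?e = (SUP n. \<tau> n)"
    using ennreal_Sup_countable_SUP[of "{?b..<?e}"] True Sup by force
  have "phase_time \<rho> J k = (\<Union>n. I (\<tau> n))"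
  proof (intro set_eqI iffI)
    fix t assume "t \<in> phase_time \<rho> J k"
    then have "0 \<le> t" "?b \<le> ennreal t" "ennreal t < (SUP n. \<tau> n)"
      by (auto simp: phase_time_def in_phase_def \<tau>(3)[symmetric])
    then show "t \<in> (\<Union>n. I (\<tau> n))" by (auto simp: I_def less_SUP_iff intro: less_imp_le)
  next
    fix t assume "t \<in> (\<Union>n. I (\<tau> n))"
    then obtain n where "t \<in> I (\<tau> n)" by blast
    moreover have "\<tau> n < ?e" using \<tau>(2) by (auto simp: image_subset_iff)
    ultimately show "t \<in> phase_time \<rho> J k"
      using k le_less_trans by (auto simp: phase_time_def in_phase_def I_def)
  qed
  moreover have "incseq (\<lambda>n. I (\<tau> n))"
    using \<tau>(1) by (auto simp: incseq_def I_def intro: order_trans)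
  ultimately have "emeasure (density lborel f) (phase_time \<rho> J k)
      = (SUP n. emeasure (density lborel f) (I (\<tau> n)))"
    by (simp add: SUP_emeasure_incseq image_subset_iff)
  also have "\<dots> \<le> ennreal (work (J ! k))"
  proof (rule SUP_least)
    fix n
    have n: "?b \<le> \<tau> n" "\<tau> n < ?e" using \<tau>(2) by (auto simp: image_subset_iff)
    \<comment> \<open>Otherwise \<open>\<tau> n\<close> would belong to the set whose infimum is the
      phase end.\<close>
    have "\<not> ennreal (work (J ! k)) \<le> (\<integral>\<^sup>+t\<in>I (\<tau> n). f t \<partial>lborel)"
    proof
      assume "ennreal (work (J ! k)) \<le> (\<integral>\<^sup>+t\<in>I (\<tau> n). f t \<partial>lborel)"
      then have "?e \<le> \<tau> n" using n(1) by (auto intro!: Inf_lower simp: phase_end.simps(2) I_def f_def)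
      with n(2) show False by simp
    qed
    then show "emeasure (density lborel f) (I (\<tau> n)) \<le> ennreal (work (J ! k))"
      by (simp add: nn_integral_eq_emeasure_density)
  qed
  finally show ?thesis
    by (simp add: nn_integral_eq_emeasure_density[symmetric] f_def)
qed

text \<open>Closed intervals that end late enough accumulate the work, and they shrink to the one
  that ends at the infimum; \<open>loc\<close> supplies the finiteness for continuity from above.
  The rate enters only through a measurable majorant \<open>g\<close>, which serves as the density,
  so that the bound applies to the sorted speeds of an arbitrary schedule.\<close>

lemma work_le_integral:
  fixes g :: "real \<Rightarrow> ennreal"
  assumes k: "k < length J" and fin: "phase_end \<rho> J (Suc k) < \<infinity>"
    and [measurable]: "g \<in> borel_measurable borel"
    and le: "\<And>t. 0 \<le> t \<Longrightarrow> ennreal (\<rho> (parallelism (J ! k)) t) \<le> g t"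
    and loc: "\<And>T. (\<integral>\<^sup>+t\<in>{0..T}. g t \<partial>lborel) < \<infinity>"
  shows "ennreal (work (J ! k)) \<le> (\<integral>\<^sup>+t\<in>phase_time \<rho> J k. g t \<partial>lborel)"
proof -
  let ?b = "phase_end \<rho> J k" and ?e = "phase_end \<rho> J (Suc k)"
  define I where "I \<tau> = {t. 0 \<le> t \<and> ?b \<le> ennreal t \<and> ennreal t \<le> \<tau>}" for \<tau>
  have [measurable]: "I \<tau> \<in> sets borel" for \<tau> unfolding I_def by measurable
  define B where "B = {\<tau>. ?b \<le> \<tau> \<and>
    ennreal (work (J ! k)) \<le> (\<integral>\<^sup>+ t \<in> I \<tau>. ennreal (\<rho> (parallelism (J ! k)) t) \<partial>lborel)}"
  have e: "?e = Inf B" by (simp add: phase_end.simps(2) B_def I_def)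
  have "B \<noteq> {}" using fin e by (metis Inf_empty infinity_ennreal_def less_irrefl)
  then obtain \<tau> :: "nat \<Rightarrow> ennreal" where \<tau>: "decseq \<tau>" "range \<tau> \<subseteq> B" "Inf B = (INF n. \<tau> n)"
    using ennreal_Inf_countable_INF by blast
  have "(\<Inter>n. I (\<tau> n)) = I ?e"
    by (auto simp: I_def e \<tau>(3) le_INF_iff)
  moreover have "decseq (\<lambda>n. I (\<tau> n))"
    using \<tau>(1) by (auto simp: decseq_def I_def intro: order_trans)
  moreover have "\<exists>n. emeasure (density lborel g) (I (\<tau> n)) \<noteq> \<infinity>"
  proof -
    obtain n where "\<tau> n < \<infinity>"
      using fin unfolding e \<tau>(3) INF_less_iff by blast
    then obtain T where T: "0 \<le> T" "\<tau> n = ennreal T" by (cases "\<tau> n") auto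
    have "emeasure (density lborel g) (I (\<tau> n)) \<le> emeasure (density lborel g) {0..T}"
      using T by (intro emeasure_mono) (auto simp: I_def)
    also have "\<dots> < \<infinity>" using loc[of T] by (simp add: nn_integral_eq_emeasure_density)
    finally show ?thesis by (intro exI[of _ n]) simp
  qed
  ultimately have "emeasure (density lborel g) (I ?e) = (INF n. emeasure (density lborel g) (I (\<tau> n)))"
    using INF_emeasure_decseq'[of "\<lambda>n. I (\<tau> n)" "density lborel g"] by simp
  moreover have "ennreal (work (J ! k)) \<le> emeasure (density lborel g) (I (\<tau> n))" for n
  proof -
    have "ennreal (work (J ! k)) \<le> (\<integral>\<^sup>+ t \<in> I (\<tau> n). ennreal (\<rho> (parallelism (J ! k)) t) \<partial>lborel)"
      using \<tau>(2) by (auto simp: B_def)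
    also have "\<dots> \<le> (\<integral>\<^sup>+ t \<in> I (\<tau> n). g t \<partial>lborel)"
      using le by (intro nn_integral_mono) (auto simp: I_def indicator_def)
    finally show ?thesis by (simp add: nn_integral_eq_emeasure_density)
  qed
  ultimately have "ennreal (work (J ! k)) \<le> emeasure (density lborel g) (I ?e)"
    by (simp add: le_INF_iff)
  \<comment> \<open>The closed interval contains its right endpoint, the phase does not; the extra
    point is a null set.\<close>
  also have "\<dots> \<le> emeasure (density lborel g) (phase_time \<rho> J k \<union> {enn2real ?e})"
  proof (rule emeasure_mono)
    show "I ?e \<subseteq> phase_time \<rho> J k \<union> {enn2real ?e}"
    proof
      fix t assume t: "t \<in> I ?e"
      show "t \<in> phase_time \<rho> J k \<union> {enn2real ?e}"
      proof (cases "ennreal t = ?e")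
        case True
        then have "t = enn2real ?e" using t by (simp add: I_def flip: True)
        then show ?thesis by simp
      next
        case False
        then show ?thesis using t k by (auto simp: I_def phase_time_def in_phase_def)
      qed
    qed
  qed simp
  also have "\<dots> \<le> emeasure (density lborel g) (phase_time \<rho> J k) + emeasure (density lborel g) {enn2real ?e}"
    by (intro emeasure_subadditive) auto
  also have "emeasure (density lborel g) {enn2real ?e} = 0"
    by (simp add: emeasure_density nn_integral_0_iff_AE)
  finally show ?thesis by (simp add: nn_integral_eq_emeasure_density)
qed

text \<open>The phases of a job occupy disjoint times before its completion, so the bounds for
  single phases add up to one integral over the life of the job.\<close>

lemma sum_work_le_integral:
  fixes g :: "real \<Rightarrow> ennreal"
  assumes K: "K \<subseteq> {..<length J}" and fin: "completion \<rho> J < \<infinity>"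
    and [measurable]: "g \<in> borel_measurable borel"
    and le: "\<And>k t. k \<in> K \<Longrightarrow> 0 \<le> t \<Longrightarrow> ennreal (\<rho> (parallelism (J ! k)) t) \<le> g t"
    and loc: "\<And>T. (\<integral>\<^sup>+t\<in>{0..T}. g t \<partial>lborel) < \<infinity>"
  shows "(\<Sum>k\<in>K. ennreal (work (J ! k))) \<le> (\<integral>\<^sup>+t\<in>{t. 0 \<le> t \<and> ennreal t < completion \<rho> J}. g t \<partial>lborel)"
proof -
  have finK: "finite K" using K finite_subset by blast
  have "(\<Sum>k\<in>K. ennreal (work (J ! k))) \<le> (\<Sum>k\<in>K. emeasure (density lborel g) (phase_time \<rho> J k))"
  proof (rule sum_mono)
    fix k assume k: "k \<in> K"
    then have kl: "k < length J" using K by auto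
    then have "phase_end \<rho> J (Suc k) < \<infinity>"
      using fin phase_end_mono[of "Suc k" "length J" \<rho> J] unfolding completion_def by (meson Suc_leI le_less_trans)
    then show "ennreal (work (J ! k)) \<le> emeasure (density lborel g) (phase_time \<rho> J k)"
      using work_le_integral[of k J \<rho> g] kl le[OF k] loc by (simp add: nn_integral_eq_emeasure_density)
  qed
  also have "\<dots> = emeasure (density lborel g) (\<Union>k\<in>K. phase_time \<rho> J k)"
    using finK by (intro sum_emeasure) (auto simp: disjoint_phase_time)
  also have "\<dots> \<le> emeasure (density lborel g) {t. 0 \<le> t \<and> ennreal t < completion \<rho> J}"
    using active_iff_in_phase[of _ \<rho> J] by (intro emeasure_mono) (auto simp: phase_time_def active_def)
  finally show ?thesis by (simp add: nn_integral_eq_emeasure_density)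
qed

section \<open>Lower bounds for arbitrary schedules\<close>

text \<open>If \<open>x\<close> exceeds \<open>c\<close>, then \<open>x\<close> is the product of
  its powers \<open>1 - \<alpha>\<close> and \<open>\<alpha>\<close>, and the first of them is at
  most \<open>c powr (1 - \<alpha>)\<close>. The parameter \<open>c\<close> is the speed up to which
  work is charged to time and beyond which it is charged to energy.\<close>

lemma le_add_powr:
  fixes x c \<alpha> :: real
  assumes "\<alpha> > 1" "c > 0" "x \<ge> 0"
  shows "x \<le> c + c powr (1 - \<alpha>) * x powr \<alpha>"
proof (cases "x \<le> c")
  case True
  then show ?thesis by (simp add: add_increasing2)
next
  case False
  then have "x = x powr (1 - \<alpha>) * x powr \<alpha>"
    using assms by (simp flip: powr_add)
  also have "\<dots> \<le> c powr (1 - \<alpha>) * x powr \<alpha>"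
    using assms False by (intro mult_right_mono powr_mono2') auto
  finally show ?thesis using assms by simp
qed

text \<open>All entries of the sorted list are summed, and passing to multisets removes the
  order.\<close>

lemma exec_rate_infinity:
  assumes "finite A"
  shows "exec_rate \<infinity> A v = (\<Sum>p\<in>A. v p)"
proof -
  let ?L = "speeds_desc A v"
  have len: "length ?L = card A" by (simp add: speeds_desc_def)
  have "{j::nat. 1 \<le> j \<and> ereal (real j) \<le> min (ereal (real (card A))) \<infinity>} = {1..card A}"
    by auto
  then have "exec_rate \<infinity> A v = (\<Sum>j=1..card A. ?L ! (j - 1))"
    by (simp add: exec_rate_def)
  also have "\<dots> = (\<Sum>j<card A. ?L ! j)"
    by (rule sum.reindex_bij_witness[of _ Suc "\<lambda>j. j - 1"]) auto
  also have "\<dots> = sum_list ?L"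
    by (simp add: sum_list_sum_nth len atLeast0LessThan)
  also have "\<dots> = sum_mset (mset ?L)" by (simp add: sum_mset_sum_list)
  also have "mset ?L = mset (map v (sorted_list_of_set A))"
    by (simp add: speeds_desc_def)
  also have "sum_mset \<dots> = sum_list (map v (sorted_list_of_set A))"
    by (rule sum_mset_sum_list)
  also have "\<dots> = (\<Sum>p\<in>A. v p)"
    using assms by (subst sum_list_distinct_conv_sum_set) auto
  finally show ?thesis .
qed

text \<open>With parallelism 1 only the head of the list of speeds counts, and it is the speed of
  some processor in \<open>A\<close>.\<close>

lemma exec_rate_one_cases:
  assumes "finite A"
  shows "A = {} \<and> exec_rate 1 A v = 0 \<or> (\<exists>p\<in>A. exec_rate 1 A v = v p)"
proof (cases "A = {}")
  case True
  have "{j::nat. 1 \<le> j \<and> ereal (real j) \<le> min (ereal (real (card A))) 1} = {}"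
    using True by auto
  then have "exec_rate 1 A v = 0"
    by (simp only: exec_rate_def sum.empty)
  then show ?thesis using True by simp
next
  case False
  let ?L = "speeds_desc A v"
  have card: "card A > 0" using False assms by (simp add: card_gt_0_iff)
  have "{j::nat. 1 \<le> j \<and> ereal (real j) \<le> min (ereal (real (card A))) 1} = {1}"
    using card by (auto simp: one_ereal_def)
  then have "exec_rate 1 A v = ?L ! 0" by (simp add: exec_rate_def)
  moreover have "?L ! 0 \<in> set ?L"
    using card by (intro nth_mem) (simp add: speeds_desc_def)
  moreover have "set ?L = v ` A" using assms by (simp add: speeds_desc_def)
  ultimately show ?thesis by auto
qed

section \<open>Shares of single jobs in power and processors\<close>

definition job_power :: "real \<Rightarrow> nat \<Rightarrow> schedule \<Rightarrow> nat \<Rightarrow> real \<Rightarrow> real" where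
  "job_power \<alpha> P \<sigma> i t = (\<Sum>p<P. if p \<in> procs \<sigma> i t then speed \<sigma> t p powr \<alpha> else 0)"

text \<open>As in \<open>job_power\<close>, the sum runs over all processors with a condition
  inside: the index set does not vary with \<open>t\<close>, so measurability follows term by term.
  The value is the number of processors held by the job.\<close>

definition job_procs :: "nat \<Rightarrow> schedule \<Rightarrow> nat \<Rightarrow> real \<Rightarrow> real" where
  "job_procs P \<sigma> i t = (\<Sum>p<P. if p \<in> procs \<sigma> i t then 1 else 0)"

lemma job_power_nonneg: "0 \<le> job_power \<alpha> P \<sigma> i t"
  unfolding job_power_def by (intro sum_nonneg) auto

lemma job_procs_nonneg: "0 \<le> job_procs P \<sigma> i t"
  unfolding job_procs_def by (intro sum_nonneg) auto

lemma job_procs_le: "job_procs P \<sigma> i t \<le> real P"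
  unfolding job_procs_def using sum_bounded_above[of "{..<P}" _ "1::real"] by simp

lemma job_power_measurable:
  assumes "valid_schedule P js \<sigma>" "i < length js"
  shows "job_power \<alpha> P \<sigma> i \<in> borel_measurable borel"
proof -
  have [measurable]: "Measurable.pred borel (\<lambda>t. p \<in> procs \<sigma> i t)"
      "(\<lambda>t. speed \<sigma> t p) \<in> borel_measurable borel" if "p < P" for p
    using assms that by (auto simp: valid_schedule_def pred_def)
  show ?thesis unfolding job_power_def by (intro borel_measurable_sum) simp
qed

lemma job_procs_measurable:
  assumes "valid_schedule P js \<sigma>" "i < length js"
  shows "job_procs P \<sigma> i \<in> borel_measurable borel"
proof -
  have [measurable]: "Measurable.pred borel (\<lambda>t. p \<in> procs \<sigma> i t)" if "p < P" for p
    using assms that by (auto simp: valid_schedule_def pred_def)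
  show ?thesis unfolding job_procs_def by (intro borel_measurable_sum) simp
qed

text \<open>A processor lies in at most one of the disjoint sets, so summing over the jobs counts
  its contribution at most once.\<close>

lemma sum_disjoint_indicators_le:
  fixes x :: real
  assumes "disjoint_family_on A I" "finite I" "0 \<le> x"
  shows "(\<Sum>i\<in>I. if p \<in> A i then x else 0) \<le> x"
proof (cases "\<exists>i\<in>I. p \<in> A i")
  case True
  then obtain j where j: "j \<in> I" "p \<in> A j" by blast
  then have "p \<in> A i \<longleftrightarrow> i = j" if "i \<in> I" for i
    using assms(1) that unfolding disjoint_family_on_def by blast
  then have "(\<Sum>i\<in>I. if p \<in> A i then x else 0) = (\<Sum>i\<in>I. if i = j then x else 0)"
    by (intro sum.cong) auto
  then show ?thesis using j assms by simp
next
  case False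
  then have "(\<Sum>i\<in>I. if p \<in> A i then x else 0) = 0" by (intro sum.neutral) auto
  then show ?thesis using assms by simp
qed

lemma sum_job_power_le:
  assumes "valid_schedule P js \<sigma>" "0 \<le> t"
  shows "(\<Sum>i<length js. job_power \<alpha> P \<sigma> i t) \<le> sched_power \<alpha> P \<sigma> t"
  unfolding job_power_def sched_power_def
  using assms by (subst sum.swap) (intro sum_mono sum_disjoint_indicators_le; simp add: valid_schedule_def)

lemma sum_job_procs_le:
  assumes "valid_schedule P js \<sigma>" "0 \<le> t"
  shows "(\<Sum>i<length js. job_procs P \<sigma> i t) \<le> real P"
proof -
  have "(\<Sum>i<length js. job_procs P \<sigma> i t) \<le> (\<Sum>p<P. 1)"
    unfolding job_procs_def
    using assms by (subst sum.swap) (intro sum_mono sum_disjoint_indicators_le; simp add: valid_schedule_def)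
  then show ?thesis by simp
qed

lemma sum_energy_job_power_le:
  assumes "valid_schedule P js \<sigma>"
  shows "(\<Sum>i<length js. energy (job_power \<alpha> P \<sigma> i)) \<le> energy (sched_power \<alpha> P \<sigma>)"
proof -
  have "(\<Sum>i<length js. energy (job_power \<alpha> P \<sigma> i))
      = (\<integral>\<^sup>+t. (\<Sum>i<length js. ennreal (job_power \<alpha> P \<sigma> i t) * indicator {0..} t) \<partial>lborel)"
    unfolding energy_def using job_power_measurable[OF assms] by (subst nn_integral_sum) auto
  also have "\<dots> \<le> energy (sched_power \<alpha> P \<sigma>)"
    unfolding energy_def
  proof (rule nn_integral_mono)
    fix t :: real
    show "(\<Sum>i<length js. ennreal (job_power \<alpha> P \<sigma> i t) * indicator {0..} t)
        \<le> ennreal (sched_power \<alpha> P \<sigma> t) * indicator {0..} t"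
      using sum_job_power_le[OF assms, of t \<alpha>] job_power_nonneg
      by (auto simp: indicator_def intro!: ennreal_leI)
  qed
  finally show ?thesis .
qed

section \<open>From rates to bounds on work\<close>

lemma emeasure_before: "emeasure lborel {t. 0 \<le> t \<and> ennreal t < c} = c"
proof (cases c)
  case (real r)
  then have "{t. 0 \<le> t \<and> ennreal t < c} = {0..<r}" by (auto simp: ennreal_less_iff)
  then show ?thesis using real by simp
next
  case top
  then have "{t. 0 \<le> t \<and> ennreal t < c} = {0..}" by auto
  moreover have "emeasure lborel {0::real..} = \<infinity>"
  proof -
    have "of_nat n \<le> emeasure lborel {0::real..}" for n
    proof -
      have "emeasure lborel {0..real n} \<le> emeasure lborel {0::real..}"
        by (intro emeasure_mono) auto
      then show ?thesis by (simp add: ennreal_of_nat_eq_real_of_nat)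
    qed
    then show ?thesis
      by (metis ennreal_SUP_of_nat_eq_top SUP_least top.extremum_uniqueI infinity_ennreal_def)
  qed
  ultimately show ?thesis using top by simp
qed

text \<open>Common form of the lower bounds, obtained by integrating the bound on the rate over the
  life of the job. The resource \<open>q\<close> is 1 when time is charged and the number of
  processors when processor time is charged.\<close>

lemma sum_work_le_resources:
  assumes valid: "valid_schedule P js \<sigma>" and i: "i < length js"
    and energy: "energy (sched_power \<alpha> P \<sigma>) < \<infinity>"
    and K: "K \<subseteq> {..<length (js ! i)}"
    and [measurable]: "q \<in> borel_measurable borel" and q: "\<And>t. 0 \<le> q t" "\<And>t. q t \<le> b"
    and cd: "0 \<le> c" "0 \<le> d"
    and le: "\<And>k t. k \<in> K \<Longrightarrow> 0 \<le> t \<Longrightarrow>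
      sched_rate \<sigma> i (parallelism (js ! i ! k)) t \<le> c * q t + d * job_power \<alpha> P \<sigma> i t"
  shows "(\<Sum>k\<in>K. ennreal (work (js ! i ! k))) \<le>
    ennreal c * (\<integral>\<^sup>+t\<in>{t. 0 \<le> t \<and> ennreal t < makespan (sched_rate \<sigma>) js}. ennreal (q t) \<partial>lborel)
      + ennreal d * energy (job_power \<alpha> P \<sigma> i)"
proof -
  note [measurable] = job_power_measurable[OF valid i]
  define g where "g t = ennreal c * ennreal (q t) + ennreal d * ennreal (job_power \<alpha> P \<sigma> i t)" for t
  have [measurable]: "g \<in> borel_measurable borel" unfolding g_def by measurable
  let ?D = "{t. 0 \<le> t \<and> ennreal t < completion (sched_rate \<sigma> i) (js ! i)}"
  let ?M = "{t. 0 \<le> t \<and> ennreal t < makespan (sched_rate \<sigma>) js}"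
  have int: "(\<integral>\<^sup>+t\<in>X. g t \<partial>lborel)
      \<le> ennreal c * (\<integral>\<^sup>+t\<in>X. ennreal (q t) \<partial>lborel) + ennreal d * energy (job_power \<alpha> P \<sigma> i)"
    if [measurable]: "X \<in> sets borel" and X: "X \<subseteq> {0..}" for X
  proof -
    have "(\<integral>\<^sup>+t\<in>X. g t \<partial>lborel) = (\<integral>\<^sup>+t. ennreal c * (ennreal (q t) * indicator X t)
        + ennreal d * (ennreal (job_power \<alpha> P \<sigma> i t) * indicator X t) \<partial>lborel)"
      by (intro nn_integral_cong) (simp add: g_def algebra_simps)
    also have "\<dots> = ennreal c * (\<integral>\<^sup>+t\<in>X. ennreal (q t) \<partial>lborel)
        + ennreal d * (\<integral>\<^sup>+t\<in>X. ennreal (job_power \<alpha> P \<sigma> i t) \<partial>lborel)"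
      by (simp add: nn_integral_add nn_integral_cmult)
    also have "(\<integral>\<^sup>+t\<in>X. ennreal (job_power \<alpha> P \<sigma> i t) \<partial>lborel) \<le> energy (job_power \<alpha> P \<sigma> i)"
      unfolding energy_def using X by (intro nn_integral_mono) (auto simp: indicator_def)
    finally show ?thesis by (simp add: mult_left_mono)
  qed
  have comp: "completion (sched_rate \<sigma> i) (js ! i) < \<infinity>"
    using valid i by (simp add: valid_schedule_def)
  have "energy (job_power \<alpha> P \<sigma> i) \<le> (\<Sum>i<length js. energy (job_power \<alpha> P \<sigma> i))"
    using i by (intro member_le_sum) auto
  then have E: "energy (job_power \<alpha> P \<sigma> i) < \<infinity>"
    using sum_energy_job_power_le[OF valid, of \<alpha>] energy by (meson le_less_trans)
  \<comment> \<open>Local integrability of the majorant comes from the bound \<open>b\<close> on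
    \<open>q\<close> and from the finite energy.\<close>
  have loc: "(\<integral>\<^sup>+t\<in>{0..T}. g t \<partial>lborel) < \<infinity>" for T
  proof -
    have "(\<integral>\<^sup>+t\<in>{0..T}. ennreal (q t) \<partial>lborel) \<le> (\<integral>\<^sup>+t\<in>{0..T}. ennreal b \<partial>lborel)"
      using q by (intro nn_integral_mono) (auto simp: indicator_def intro: ennreal_leI)
    also have "\<dots> < \<infinity>"
      by (simp add: nn_integral_cmult_indicator ennreal_mult_less_top emeasure_lborel_Icc_eq)
    finally have "ennreal c * (\<integral>\<^sup>+t\<in>{0..T}. ennreal (q t) \<partial>lborel) + ennreal d * energy (job_power \<alpha> P \<sigma> i) < \<infinity>"
      using E by (simp add: ennreal_mult_less_top)
    with int[of "{0..T}"] show ?thesis using le_less_trans by fastforce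
  qed
  have "(\<Sum>k\<in>K. ennreal (work (js ! i ! k))) \<le> (\<integral>\<^sup>+t\<in>?D. g t \<partial>lborel)"
  proof (rule sum_work_le_integral[OF K comp _ _ loc])
    fix k t assume "k \<in> K" "0 \<le> (t::real)"
    then have "ennreal (sched_rate \<sigma> i (parallelism (js ! i ! k)) t)
        \<le> ennreal (c * q t + d * job_power \<alpha> P \<sigma> i t)"
      by (intro ennreal_leI le)
    also have "\<dots> = g t"
      using cd q job_power_nonneg by (simp add: g_def ennreal_mult)
    finally show "ennreal (sched_rate \<sigma> i (parallelism (js ! i ! k)) t) \<le> g t" .
  qed simp
  also have "\<dots> \<le> (\<integral>\<^sup>+t\<in>?M. g t \<partial>lborel)"
  proof -
    have "completion (sched_rate \<sigma> i) (js ! i) \<le> makespan (sched_rate \<sigma>) js"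
      using i unfolding makespan_def by (intro SUP_upper2[of i]) auto
    then show ?thesis
      by (intro nn_integral_mono) (auto simp: indicator_def intro: less_le_trans)
  qed
  also note int[of ?M]
  finally show ?thesis by auto
qed

lemma valid_schedule_procs:
  assumes "valid_schedule P js \<sigma>" "i < length js" "0 \<le> t"
  shows "procs \<sigma> i t \<subseteq> {..<P}" "finite (procs \<sigma> i t)" "\<And>p. p \<in> procs \<sigma> i t \<Longrightarrow> 0 \<le> speed \<sigma> t p"
proof -
  show *: "procs \<sigma> i t \<subseteq> {..<P}" using assms by (simp add: valid_schedule_def)
  then show "finite (procs \<sigma> i t)" using finite_subset by blast
  show "0 \<le> speed \<sigma> t p" if "p \<in> procs \<sigma> i t" for p
  proof -
    have "p < P" using * that by auto
    then show ?thesis using assms by (simp add: valid_schedule_def)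
  qed
qed

lemma job_power_eq:
  assumes "valid_schedule P js \<sigma>" "i < length js" "0 \<le> t"
  shows "job_power \<alpha> P \<sigma> i t = (\<Sum>p\<in>procs \<sigma> i t. speed \<sigma> t p powr \<alpha>)"
  using valid_schedule_procs[OF assms] unfolding job_power_def
  by (simp add: sum.If_cases Int_absorb1 flip: sum.inter_restrict)

lemma job_procs_eq:
  assumes "valid_schedule P js \<sigma>" "i < length js" "0 \<le> t"
  shows "job_procs P \<sigma> i t = (\<Sum>p\<in>procs \<sigma> i t. 1)"
  using valid_schedule_procs[OF assms] unfolding job_procs_def
  by (simp add: sum.If_cases Int_absorb1)

text \<open>Unless the job holds no processor, a single one determines the rate, and its power is
  part of the power of the job.\<close>

lemma sequential_rate_le:
  assumes valid: "valid_schedule P js \<sigma>" "i < length js" "0 \<le> t" and c: "\<alpha> > 1" "0 < c"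
  shows "sched_rate \<sigma> i 1 t \<le> c + c powr (1 - \<alpha>) * job_power \<alpha> P \<sigma> i t"
proof -
  let ?A = "procs \<sigma> i t" and ?v = "speed \<sigma> t"
  note A = valid_schedule_procs[OF valid]
  from exec_rate_one_cases[OF A(2), of ?v] show ?thesis
  proof
    assume "?A = {} \<and> exec_rate 1 ?A ?v = 0"
    then have "sched_rate \<sigma> i 1 t = 0" unfolding sched_rate_def by blast
    then show ?thesis using c job_power_nonneg[of \<alpha> P \<sigma> i t] by simp
  next
    assume "\<exists>p\<in>?A. exec_rate 1 ?A ?v = ?v p"
    then obtain p where p: "p \<in> ?A" "exec_rate 1 ?A ?v = ?v p" by blast
    have "?v p \<le> c + c powr (1 - \<alpha>) * ?v p powr \<alpha>"
      using A(3)[OF p(1)] c by (intro le_add_powr) auto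
    also have "?v p powr \<alpha> \<le> job_power \<alpha> P \<sigma> i t"
      unfolding job_power_eq[OF valid] using p A by (intro member_le_sum) auto
    finally show ?thesis using p by (simp add: sched_rate_def mult_left_mono)
  qed
qed

text \<open>Either kind of phase runs at most at the sum of the speeds; the speed bound is applied
  to every processor, so \<open>c\<close> is paid once per processor.\<close>

lemma par_seq_rate_le:
  assumes valid: "valid_schedule P js \<sigma>" "i < length js" "0 \<le> t" and c: "\<alpha> > 1" "0 < c"
    and h: "h = 1 \<or> h = \<infinity>"
  shows "sched_rate \<sigma> i h t \<le> c * job_procs P \<sigma> i t + c powr (1 - \<alpha>) * job_power \<alpha> P \<sigma> i t"
proof -
  let ?A = "procs \<sigma> i t" and ?v = "speed \<sigma> t"
  note A = valid_schedule_procs[OF valid]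
  have "sched_rate \<sigma> i h t \<le> (\<Sum>p\<in>?A. ?v p)"
  proof -
    have "exec_rate 1 ?A ?v \<le> (\<Sum>p\<in>?A. ?v p)"
      using exec_rate_one_cases[OF A(2), of ?v] A member_le_sum[of _ ?A ?v] by auto
    then show ?thesis using h exec_rate_infinity[OF A(2)] by (auto simp: sched_rate_def)
  qed
  also have "\<dots> \<le> (\<Sum>p\<in>?A. c * 1 + c powr (1 - \<alpha>) * ?v p powr \<alpha>)"
    using A c by (intro sum_mono) (simp add: le_add_powr)
  also have "\<dots> = c * job_procs P \<sigma> i t + c powr (1 - \<alpha>) * job_power \<alpha> P \<sigma> i t"
    by (simp only: job_power_eq[OF valid] job_procs_eq[OF valid] sum.distrib sum_distrib_left)
  finally show ?thesis .
qed

definition sequential_work :: "job \<Rightarrow> ennreal" where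
  "sequential_work J = (\<Sum>k\<in>{k. k < length J \<and> parallelism (J ! k) = 1}. ennreal (work (J ! k)))"

definition total_work :: "job \<Rightarrow> ennreal" where
  "total_work J = (\<Sum>k<length J. ennreal (work (J ! k)))"

lemma sequential_work_le:
  assumes valid: "valid_schedule P js \<sigma>" and i: "i < length js"
    and energy: "energy (sched_power \<alpha> P \<sigma>) < \<infinity>" and c: "\<alpha> > 1" "0 < c"
  shows "sequential_work (js ! i) \<le> ennreal c * makespan (sched_rate \<sigma>) js
    + ennreal (c powr (1 - \<alpha>)) * energy (job_power \<alpha> P \<sigma> i)"
proof -
  have "sequential_work (js ! i) \<le> ennreal c *
    (\<integral>\<^sup>+t\<in>{t. 0 \<le> t \<and> ennreal t < makespan (sched_rate \<sigma>) js}. ennreal 1 \<partial>lborel)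
    + ennreal (c powr (1 - \<alpha>)) * energy (job_power \<alpha> P \<sigma> i)"
    unfolding sequential_work_def
    using sequential_rate_le[OF valid i _ c] c
    by (intro sum_work_le_resources[OF valid i energy, where b=1]) auto
  also have "(\<integral>\<^sup>+t\<in>{t. 0 \<le> t \<and> ennreal t < makespan (sched_rate \<sigma>) js}. ennreal 1 \<partial>lborel)
      = makespan (sched_rate \<sigma>) js"
    by (simp add: emeasure_before)
  finally show ?thesis .
qed

text \<open>Here \<open>q\<close> is the number of processors of the job. Summed over the jobs it is
  at most \<open>P\<close> at each time, whence the factor \<open>c * P\<close> of the makespan, and
  the energies of the jobs add up to at most the total energy.\<close>

lemma sum_total_work_le:
  assumes valid: "valid_schedule P js \<sigma>" and ps: "\<forall>J\<in>set js. par_seq J"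
    and energy: "energy (sched_power \<alpha> P \<sigma>) < \<infinity>" and c: "\<alpha> > 1" "0 < c"
  shows "(\<Sum>i<length js. total_work (js ! i)) \<le> ennreal (c * real P) * makespan (sched_rate \<sigma>) js
    + ennreal (c powr (1 - \<alpha>)) * energy (sched_power \<alpha> P \<sigma>)"
proof -
  let ?X = "{t. 0 \<le> t \<and> ennreal t < makespan (sched_rate \<sigma>) js}"
  let ?Q = "\<lambda>i. \<integral>\<^sup>+t\<in>?X. ennreal (job_procs P \<sigma> i t) \<partial>lborel"
  have "(\<Sum>i<length js. total_work (js ! i)) \<le> (\<Sum>i<length js. ennreal c * ?Q i
    + ennreal (c powr (1 - \<alpha>)) * energy (job_power \<alpha> P \<sigma> i))"
  proof (rule sum_mono)
    fix i assume "i \<in> {..<length js}"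
    then have i: "i < length js" by simp
    show "total_work (js ! i) \<le> ennreal c * ?Q i + ennreal (c powr (1 - \<alpha>)) * energy (job_power \<alpha> P \<sigma> i)"
      unfolding total_work_def
    proof (rule sum_work_le_resources[OF valid i energy, where b="real P"])
      fix k t assume k: "k \<in> {..<length (js ! i)}" and t: "0 \<le> (t::real)"
      have "parallelism (js ! i ! k) = 1 \<or> parallelism (js ! i ! k) = \<infinity>"
        using ps i k unfolding par_seq_def by (metis lessThan_iff nth_mem)
      then show "sched_rate \<sigma> i (parallelism (js ! i ! k)) t
        \<le> c * job_procs P \<sigma> i t + c powr (1 - \<alpha>) * job_power \<alpha> P \<sigma> i t"
        using par_seq_rate_le[OF valid i t c] by simp
    qed (use c job_procs_measurable[OF valid i] job_procs_nonneg job_procs_le in auto)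
  qed
  also have "\<dots> = ennreal c * (\<Sum>i<length js. ?Q i)
      + ennreal (c powr (1 - \<alpha>)) * (\<Sum>i<length js. energy (job_power \<alpha> P \<sigma> i))"
    by (simp add: sum.distrib sum_distrib_left)
  also have "(\<Sum>i<length js. ?Q i) \<le> ennreal (real P) * makespan (sched_rate \<sigma>) js"
  proof -
    have "(\<Sum>i<length js. ?Q i) = (\<integral>\<^sup>+t. (\<Sum>i<length js. ennreal (job_procs P \<sigma> i t) * indicator ?X t) \<partial>lborel)"
      using job_procs_measurable[OF valid] by (subst nn_integral_sum) auto
    also have "\<dots> \<le> (\<integral>\<^sup>+t. ennreal (real P) * indicator ?X t \<partial>lborel)"
    proof (rule nn_integral_mono)
      fix t :: real
      show "(\<Sum>i<length js. ennreal (job_procs P \<sigma> i t) * indicator ?X t) \<le> ennreal (real P) * indicator ?X t"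
        using sum_job_procs_le[OF valid, of t] job_procs_nonneg
        by (auto simp: indicator_def intro!: ennreal_leI)
    qed
    finally show ?thesis by (simp add: nn_integral_cmult_indicator emeasure_before)
  qed
  also have "(\<Sum>i<length js. energy (job_power \<alpha> P \<sigma> i)) \<le> energy (sched_power \<alpha> P \<sigma>)"
    by (rule sum_energy_job_power_le[OF valid])
  finally show ?thesis
    using c by (simp add: mult_left_mono add_right_mono ennreal_mult mult.assoc)
qed

section \<open>Executions of P-FIRST\<close>

lemma p_first_speed_pos: "\<alpha> > 1 \<Longrightarrow> 0 < m \<Longrightarrow> 0 < p_first_speed \<alpha> m"
  by (simp add: p_first_speed_def)

text \<open>The speed is chosen so that the power of \<open>m\<close> processors does not depend on
  \<open>m\<close>.\<close>

lemma p_first_speed_powr: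
  assumes "\<alpha> > 1" "0 < m"
  shows "real m * p_first_speed \<alpha> m powr \<alpha> = 1 / (\<alpha> - 1)"
  using assms by (simp add: p_first_speed_def powr_powr)

text \<open>The speed is the power \<open>-1/\<alpha>\<close> of \<open>(\<alpha> - 1) * m\<close>;
  the product form lets the left side be inserted as a factor 1.\<close>

lemma p_first_speed_mult:
  assumes "\<alpha> > 1" "0 < m"
  shows "(\<alpha> - 1) powr (1 / \<alpha>) * real m powr (1 / \<alpha>) * p_first_speed \<alpha> m = 1"
proof -
  have "(\<alpha> - 1) powr (1 / \<alpha>) * real m powr (1 / \<alpha>) * p_first_speed \<alpha> m
      = (((\<alpha> - 1) * real m) * (1 / ((\<alpha> - 1) * real m))) powr (1 / \<alpha>)"
    using assms by (simp only: p_first_speed_def powr_mult)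
  also have "\<dots> = 1" using assms by simp
  finally show ?thesis .
qed

text \<open>In an enumeration by decreasing value the indices with value above \<open>x\<close> form
  an initial segment, whose length is their number. With completion times as values, the job of rank
  \<open>j\<close>, counted from 0, is active exactly while more than \<open>j\<close> jobs
  are.\<close>

lemma ex_decreasing_enumeration:
  fixes c :: "nat \<Rightarrow> ennreal"
  obtains \<pi> where "bij_betw \<pi> {..<n} {..<n}"
    "\<And>j x. j < n \<Longrightarrow> x < c (\<pi> j) \<longleftrightarrow> j < card {i. i < n \<and> x < c i}"
proof -
  define xs where "xs = rev (sort_key c [0..<n])"
  define \<pi> where "\<pi> j = xs ! j" for j
  have len: "length xs = n" and dist: "distinct xs" and set: "set xs = {..<n}"
    by (auto simp: xs_def)
  have bij: "bij_betw \<pi> {..<n} {..<n}"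
    unfolding \<pi>_def using bij_betw_nth[OF dist] len set by simp
  have dec: "c (\<pi> j) \<le> c (\<pi> i)" if "i \<le> j" "j < n" for i j
  proof -
    have "sorted (map c (sort_key c [0..<n]))" by simp
    then have "sorted_wrt (\<ge>) (map c xs)"
      unfolding xs_def by (simp add: sorted_wrt_rev flip: rev_map)
    then show ?thesis
      using that len unfolding \<pi>_def
      by (cases "i = j") (auto simp: sorted_wrt_iff_nth_less)
  qed
  have "x < c (\<pi> j) \<longleftrightarrow> j < card {i. i < n \<and> x < c i}" if j: "j < n" for j x
  proof -
    define D where "D = {j. j < n \<and> x < c (\<pi> j)}"
    have "{i. i < n \<and> x < c i} = \<pi> ` D"
      using bij unfolding D_def bij_betw_def by auto
    moreover have "inj_on \<pi> D"
      using bij by (auto simp: D_def bij_betw_def intro: inj_on_subset)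
    ultimately have card: "card {i. i < n \<and> x < c i} = card D" by (simp add: card_image)
    have fin: "finite D" by (simp add: D_def)
    show ?thesis
    proof
      assume "x < c (\<pi> j)"
      then have "{..j} \<subseteq> D" using j dec by (force simp: D_def intro: less_le_trans)
      then have "card {..j} \<le> card D" using fin by (rule card_mono[rotated])
      then show "j < card {i. i < n \<and> x < c i}" using card by simp
    next
      assume *: "j < card {i. i < n \<and> x < c i}"
      show "x < c (\<pi> j)"
      proof (rule ccontr)
        assume "\<not> x < c (\<pi> j)"
        then have "D \<subseteq> {..<j}"
          using dec by (auto simp: D_def) (meson leI le_less_trans less_le_trans not_less)
        then have "card D \<le> card {..<j}" by (intro card_mono) auto
        with * card show False by simp
      qed
    qed
  qed
  with bij that show ?thesis by blast
qed

section \<open>Modes of a fixed execution\<close>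

locale p_first_execution =
  fixes \<alpha> :: real and P :: nat and js :: "job list"
    and a :: "nat \<Rightarrow> real \<Rightarrow> real" and s :: "real \<Rightarrow> real"
  assumes alpha: "\<alpha> > 1" and P: "P \<ge> 2"
    and jobs: "\<forall>J\<in>set js. wf_job J \<and> par_seq J"
    and pf: "p_first \<alpha> P js a s"
begin

abbreviation "n \<equiv> length js"
abbreviation "rate i \<equiv> shared_rate a s i"
abbreviation "A t \<equiv> active_jobs js a s t"
abbreviation "F t \<equiv> parallel_jobs js a s t"
abbreviation "ptime i k \<equiv> phase_time (rate i) (js ! i) k"

lemma finite_A: "finite (A t)"
  by (simp add: active_jobs_def)

lemma A_subset: "A t \<subseteq> {..<n}"
  by (auto simp: active_jobs_def)

lemma card_A_le: "card (A t) \<le> n"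
  using card_mono[OF _ A_subset] by fastforce

lemma F_subset: "F t \<subseteq> A t"
  by (auto simp: parallel_jobs_def)

lemma parallel_mode:
  assumes "0 \<le> t" "F t \<noteq> {}"
  obtains j where "j \<in> F t" "s t = p_first_speed \<alpha> P" "\<And>i. i < n \<Longrightarrow> a i t = (if i = j then real P else 0)"
  using pf assms unfolding p_first_def Let_def by (metis (no_types, lifting))

lemma sequential_mode:
  assumes "0 \<le> t" "F t = {}" "A t \<noteq> {}"
  shows "s t = p_first_speed \<alpha> (min (card (A t)) P)"
    and "i \<in> A t \<Longrightarrow> a i t = real (min (card (A t)) P) / real (card (A t))"
    and "i < n \<Longrightarrow> i \<notin> A t \<Longrightarrow> a i t = 0"
proof -
  have "s t = p_first_speed \<alpha> (min (card (A t)) P) \<and>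
    (\<forall>i<n. a i t = (if i \<in> A t then real (min (card (A t)) P) / real (card (A t)) else 0))"
    using pf assms unfolding p_first_def Let_def by simp
  then show "s t = p_first_speed \<alpha> (min (card (A t)) P)"
    and "i \<in> A t \<Longrightarrow> a i t = real (min (card (A t)) P) / real (card (A t))"
    and "i < n \<Longrightarrow> i \<notin> A t \<Longrightarrow> a i t = 0"
    using A_subset[of t] by auto
qed

lemma idle_mode:
  assumes "0 \<le> t" "A t = {}"
  shows "s t = 0"
  using pf assms F_subset[of t] unfolding p_first_def Let_def by auto

lemma rate_measurable [measurable]:
  assumes "i < n"
  shows "rate i h \<in> borel_measurable borel"
proof -
  have [measurable]: "a i \<in> borel_measurable borel" "s \<in> borel_measurable borel"
    using pf assms by (auto simp: p_first_def)
  show ?thesis unfolding shared_rate_def by measurable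
qed

text \<open>In both modes the processor shares add up to the number \<open>m\<close> for which the
  speed is set, and \<open>m\<close> processors at that speed draw power
  \<open>1 / (\<alpha> - 1)\<close>.\<close>

lemma shared_power_eq:
  assumes t: "0 \<le> t"
  shows "shared_power \<alpha> n a s t = (if A t = {} then 0 else 1 / (\<alpha> - 1))"
proof -
  consider "F t \<noteq> {}" | "F t = {}" "A t \<noteq> {}" | "A t = {}" by blast
  then show ?thesis
  proof cases
    case 1
    obtain j where j: "j \<in> F t" "s t = p_first_speed \<alpha> P" "\<And>i. i < n \<Longrightarrow> a i t = (if i = j then real P else 0)"
      using parallel_mode[OF t 1] by blast
    have "j < n" using j(1) F_subset A_subset by blast
    moreover have "(\<Sum>i<n. a i t) = (\<Sum>i<n. if i = j then real P else 0)"
      using j(3) by (intro sum.cong) auto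
    ultimately have "(\<Sum>i<n. a i t) = real P" by simp
    moreover have "A t \<noteq> {}" using j(1) F_subset by blast
    ultimately show ?thesis
      using p_first_speed_powr[OF alpha, of P] P j(2) by (simp add: shared_power_def)
  next
    case 2
    have pos: "card (A t) > 0" using 2 finite_A by (simp add: card_gt_0_iff)
    have "(\<Sum>i<n. a i t) = (\<Sum>i\<in>A t. a i t)"
      using A_subset sequential_mode(3)[OF t 2] by (intro sum.mono_neutral_right) auto
    also have "\<dots> = (\<Sum>i\<in>A t. real (min (card (A t)) P) / real (card (A t)))"
      using sequential_mode(2)[OF t 2] by (intro sum.cong) auto
    also have "\<dots> = real (min (card (A t)) P)" using pos by simp
    finally show ?thesis
      using p_first_speed_powr[OF alpha, of "min (card (A t)) P"] P pos sequential_mode(1)[OF t 2] 2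
      by (simp add: shared_power_def)
  next
    case 3
    then show ?thesis using idle_mode[OF t 3] alpha by (simp add: shared_power_def)
  qed
qed

section \<open>Busy time and cost\<close>

definition "busy = {t. 0 \<le> t \<and> A t \<noteq> {}}"

lemma active_borel [measurable]: "Measurable.pred borel (\<lambda>t. i \<in> A t)"
  unfolding active_jobs_def active_def by measurable

lemma A_empty_borel [measurable]: "Measurable.pred borel (\<lambda>t. A t = {})"
proof -
  have "(\<lambda>t. A t = {}) = (\<lambda>t. \<forall>i\<in>{..<n}. i \<notin> A t)" using A_subset by fast
  then show ?thesis by simp
qed

text \<open>The set is a countable union of phase times of phases with infinite parallelism; indices
  past the last phase contribute empty sets.\<close>

lemma F_borel: "{t. 0 \<le> t \<and> F t \<noteq> {}} \<in> sets borel"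
proof -
  have "{t. 0 \<le> t \<and> F t \<noteq> {}}
      = (\<Union>i\<in>{..<n}. \<Union>k\<in>{k. parallelism (js ! i ! k) = \<infinity>}. ptime i k)"
    by (auto simp: parallel_jobs_def active_jobs_def phase_time_def active_iff_in_phase) blast
  also have "\<dots> \<in> sets borel" by measurable
  finally show ?thesis .
qed

lemma card_A_eq: "card (A t) = (\<Sum>i<n. if i \<in> A t then 1 else 0)"
  using A_subset by (simp add: sum.If_cases Int_absorb1)

lemma card_A_borel [measurable]: "(\<lambda>t. card (A t)) \<in> measurable borel (count_space UNIV)"
  unfolding card_A_eq by measurable

lemma busy_borel [measurable]: "busy \<in> sets borel"
  unfolding busy_def by measurable

lemma emeasure_busy: "emeasure lborel busy = makespan rate js"
proof -
  have "busy = {t. 0 \<le> t \<and> ennreal t < makespan rate js}"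
    by (auto simp: busy_def makespan_def less_SUP_iff active_jobs_def active_def)
  then show ?thesis by (simp add: emeasure_before)
qed

text \<open>At constant power \<open>1 / (\<alpha> - 1)\<close> the energy is that multiple of the
  busy time, whose length is the makespan.\<close>

lemma shared_cost_eq: "shared_cost \<alpha> js a s = ennreal (\<alpha> / (\<alpha> - 1)) * emeasure lborel busy"
proof -
  have "energy (shared_power \<alpha> n a s) = (\<integral>\<^sup>+t. ennreal (1 / (\<alpha> - 1)) * indicator busy t \<partial>lborel)"
    unfolding energy_def by (intro nn_integral_cong) (auto simp: shared_power_eq busy_def indicator_def)
  also have "\<dots> = ennreal (1 / (\<alpha> - 1)) * emeasure lborel busy"
    by (simp add: nn_integral_cmult_indicator)
  finally have "shared_cost \<alpha> js a s = ennreal 1 * emeasure lborel busy + ennreal (1 / (\<alpha> - 1)) * emeasure lborel busy"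
    by (simp add: shared_cost_def emeasure_busy)
  also have "\<dots> = ennreal (1 + 1 / (\<alpha> - 1)) * emeasure lborel busy"
    using alpha by (subst ennreal_plus) (auto simp: algebra_simps)
  also have "1 + 1 / (\<alpha> - 1) = \<alpha> / (\<alpha> - 1)" using alpha by (simp add: field_simps)
  finally show ?thesis .
qed

lemma current_phase:
  assumes "0 \<le> t" "i \<in> A t"
  obtains k where "k < length (js ! i)" "t \<in> ptime i k"
    "parallelism (js ! i ! k) = 1 \<or> parallelism (js ! i ! k) = \<infinity>"
    "F t = {} \<Longrightarrow> parallelism (js ! i ! k) = 1"
proof -
  have i: "i < n" using assms A_subset by auto
  obtain k where k: "in_phase (rate i) (js ! i) k t"
    using assms active_iff_in_phase by (auto simp: active_jobs_def)
  have kl: "k < length (js ! i)" using k by (simp add: in_phase_def)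
  have ps: "parallelism (js ! i ! k) = 1 \<or> parallelism (js ! i ! k) = \<infinity>"
    using jobs i kl unfolding par_seq_def by (metis nth_mem)
  moreover have "parallelism (js ! i ! k) \<noteq> \<infinity>" if "F t = {}"
    using that assms k by (auto simp: parallel_jobs_def)
  ultimately show ?thesis using that k kl assms(1) by (auto simp: phase_time_def)
qed

text \<open>The minimum in \<open>shared_rate\<close> is the share itself as long as a sequential
  job holds at most one processor.\<close>

lemma shared_rate_eq:
  assumes "h = \<infinity> \<or> h = 1 \<and> a i t \<le> 1"
  shows "rate i h t = a i t * s t"
  using assms by (auto simp: shared_rate_def one_ereal_def min_def)

text \<open>Both cases use the whole capacity: the rates of all jobs add up to at least
  \<open>P\<close> times the speed, so the total work limits the length of this set.\<close>

definition "full_load = {t \<in> busy. F t \<noteq> {} \<or> P < card (A t)}"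

text \<open>For \<open>m \<le> P\<close> these are the times at which each of the \<open>m\<close>
  active jobs has one processor of its own.\<close>

definition "level m = {t \<in> busy. F t = {} \<and> card (A t) = m}"

lemma full_load_borel [measurable]: "full_load \<in> sets borel"
proof -
  have "full_load = ({t. 0 \<le> t \<and> F t \<noteq> {}} \<inter> busy) \<union> {t \<in> busy. P < card (A t)}"
    by (auto simp: full_load_def busy_def)
  also have "\<dots> \<in> sets borel" using F_borel by measurable
  finally show ?thesis .
qed

lemma level_borel [measurable]: "level m \<in> sets borel"
proof -
  have "level m = {t \<in> busy. card (A t) = m} - {t. 0 \<le> t \<and> F t \<noteq> {}}"
    by (auto simp: level_def busy_def)
  also have "\<dots> \<in> sets borel" using F_borel by measurable
  finally show ?thesis .
qed

lemma busy_subset: "busy \<subseteq> full_load \<union> (\<Union>m\<in>{1..min n P}. level m)"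
proof
  fix t assume t: "t \<in> busy"
  then have "card (A t) > 0" using finite_A by (simp add: busy_def card_gt_0_iff)
  then show "t \<in> full_load \<union> (\<Union>m\<in>{1..min n P}. level m)"
    using t card_A_le[of t] by (auto simp: full_load_def level_def not_less)
qed

section \<open>Work done under full load and at the levels\<close>

lemma integral_phases_le_work:
  assumes i: "i < n" and K: "K \<subseteq> {..<length (js ! i)}"
  shows "(\<integral>\<^sup>+t. (\<Sum>k\<in>K. ennreal (rate i (parallelism (js ! i ! k)) t) * indicator (ptime i k) t) \<partial>lborel)
    \<le> (\<Sum>k\<in>K. ennreal (work (js ! i ! k)))"
proof -
  have "(\<integral>\<^sup>+t. (\<Sum>k\<in>K. ennreal (rate i (parallelism (js ! i ! k)) t) * indicator (ptime i k) t) \<partial>lborel)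
    = (\<Sum>k\<in>K. \<integral>\<^sup>+t\<in>ptime i k. ennreal (rate i (parallelism (js ! i ! k)) t) \<partial>lborel)"
    using i by (intro nn_integral_sum) measurable
  also have "\<dots> \<le> (\<Sum>k\<in>K. ennreal (work (js ! i ! k)))"
    using i K by (intro sum_mono rate_integral_le_work) auto
  finally show ?thesis .
qed

text \<open>A fully-parallel job receives all \<open>P\<close> processors; otherwise the rates of
  the sharing jobs, each \<open>P / card (A t)\<close> times the speed, add up to the same
  value.\<close>

lemma full_load_rate:
  assumes t: "t \<in> full_load"
  shows "ennreal (real P * p_first_speed \<alpha> P) \<le>
    (\<Sum>i<n. \<Sum>k<length (js ! i). ennreal (rate i (parallelism (js ! i ! k)) t) * indicator (ptime i k) t)"
proof -
  let ?R = "\<lambda>i. \<Sum>k<length (js ! i). ennreal (rate i (parallelism (js ! i ! k)) t) * indicator (ptime i k) t"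
  have t0: "0 \<le> t" and A: "A t \<noteq> {}" using t by (auto simp: full_load_def busy_def)
  have R: "ennreal x \<le> ?R i" if "k < length (js ! i)" "t \<in> ptime i k" "x = rate i (parallelism (js ! i ! k)) t" for i k x
    using that member_le_sum[of k "{..<length (js ! i)}"
        "\<lambda>k. ennreal (rate i (parallelism (js ! i ! k)) t) * indicator (ptime i k) t"]
    by simp
  show ?thesis
  proof (cases "F t = {}")
    case False
    obtain j where j: "j \<in> F t" "s t = p_first_speed \<alpha> P" "\<And>i. i < n \<Longrightarrow> a i t = (if i = j then real P else 0)"
      using parallel_mode[OF t0 False] by blast
    have jn: "j < n" using j(1) F_subset A_subset by blast
    obtain k where k: "in_phase (rate j) (js ! j) k t" "parallelism (js ! j ! k) = \<infinity>"
      using j(1) by (auto simp: parallel_jobs_def)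
    have "ennreal (real P * p_first_speed \<alpha> P) \<le> ?R j"
      using k j jn t0 by (intro R[of k]) (auto simp: in_phase_def phase_time_def shared_rate_eq)
    also have "\<dots> \<le> (\<Sum>i<n. ?R i)" using jn by (intro member_le_sum) auto
    finally show ?thesis .
  next
    case True
    then have P_less: "P < card (A t)" using t by (simp add: full_load_def)
    let ?x = "real P / real (card (A t)) * p_first_speed \<alpha> P"
    have x: "0 \<le> ?x" using p_first_speed_pos[OF alpha, of P] P by simp
    have "ennreal (real P * p_first_speed \<alpha> P) = (\<Sum>i\<in>A t. ennreal ?x)"
      using P_less x by (subst sum_ennreal) auto
    also have "\<dots> \<le> (\<Sum>i\<in>A t. ?R i)"
    proof (rule sum_mono)
      fix i assume i: "i \<in> A t"
      obtain k where k: "k < length (js ! i)" "t \<in> ptime i k" "parallelism (js ! i ! k) = 1"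
        using current_phase[OF t0 i] True by metis
      \<comment> \<open>The share is below one processor, so parallelism 1 does not cut it
        down.\<close>
      show "ennreal ?x \<le> ?R i"
        using k sequential_mode[OF t0 True A] i P_less by (intro R[of k]) (auto simp: shared_rate_eq)
    qed
    also have "\<dots> \<le> (\<Sum>i<n. ?R i)" using A_subset by (intro sum_mono2) auto
    finally show ?thesis .
  qed
qed

lemma full_load_time:
  "ennreal (real P * p_first_speed \<alpha> P) * emeasure lborel full_load \<le> (\<Sum>i<n. total_work (js ! i))"
proof -
  let ?R = "\<lambda>i t. \<Sum>k<length (js ! i). ennreal (rate i (parallelism (js ! i ! k)) t) * indicator (ptime i k) t"
  have "ennreal (real P * p_first_speed \<alpha> P) * emeasure lborel full_load
      = (\<integral>\<^sup>+t. ennreal (real P * p_first_speed \<alpha> P) * indicator full_load t \<partial>lborel)"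
    by (simp add: nn_integral_cmult_indicator)
  also have "\<dots> \<le> (\<integral>\<^sup>+t. (\<Sum>i<n. ?R i t) \<partial>lborel)"
    using full_load_rate by (intro nn_integral_mono) (auto simp: indicator_def)
  also have "\<dots> = (\<Sum>i<n. \<integral>\<^sup>+t. ?R i t \<partial>lborel)"
    by (intro nn_integral_sum) measurable
  also have "\<dots> \<le> (\<Sum>i<n. total_work (js ! i))"
    unfolding total_work_def by (intro sum_mono integral_phases_le_work) auto
  finally show ?thesis .
qed

lemma level_rate:
  assumes i: "i \<in> A t" and t: "t \<in> level m" and m: "m \<le> P"
  shows "ennreal (p_first_speed \<alpha> m) \<le> (\<Sum>k\<in>{k. k < length (js ! i) \<and> parallelism (js ! i ! k) = 1}.
    ennreal (rate i (parallelism (js ! i ! k)) t) * indicator (ptime i k) t)"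
proof -
  have t0: "0 \<le> t" and A: "A t \<noteq> {}" and F: "F t = {}" and card: "card (A t) = m"
    using t by (auto simp: level_def busy_def)
  obtain k where k: "k < length (js ! i)" "t \<in> ptime i k" "parallelism (js ! i ! k) = 1"
    using current_phase[OF t0 i] F by metis
  have "m > 0" using A finite_A card by (auto simp: card_gt_0_iff)
  then have "a i t = 1" "s t = p_first_speed \<alpha> m"
    using sequential_mode[OF t0 F A] i m card by auto
  then have "ennreal (p_first_speed \<alpha> m)
      = ennreal (rate i (parallelism (js ! i ! k)) t) * indicator (ptime i k) t"
    using k by (simp add: shared_rate_eq)
  also have "\<dots> \<le> (\<Sum>k\<in>{k. k < length (js ! i) \<and> parallelism (js ! i ! k) = 1}.
    ennreal (rate i (parallelism (js ! i ! k)) t) * indicator (ptime i k) t)"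
    using k by (intro member_le_sum) auto
  finally show ?thesis .
qed

text \<open>The job of rank \<open>j\<close> is active at the levels \<open>m > j\<close> and runs
  there on one processor at speed \<open>p_first_speed \<alpha> m\<close>, always in a sequential
  phase; its sequential work limits the time it can do so.\<close>

lemma level_time:
  obtains \<pi> where "bij_betw \<pi> {..<n} {..<n}"
    "\<And>j. j < n \<Longrightarrow> (\<Sum>m\<in>{Suc j..min n P}. ennreal (p_first_speed \<alpha> m) * emeasure lborel (level m))
      \<le> sequential_work (js ! \<pi> j)"
proof -
  obtain \<pi> where \<pi>: "bij_betw \<pi> {..<n} {..<n}"
    "\<And>j x. j < n \<Longrightarrow> x < completion (rate (\<pi> j)) (js ! \<pi> j)
      \<longleftrightarrow> j < card {i. i < n \<and> x < completion (rate i) (js ! i)}"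
    using ex_decreasing_enumeration[of n "\<lambda>i. completion (rate i) (js ! i)"] by blast
  have "(\<Sum>m\<in>{Suc j..min n P}. ennreal (p_first_speed \<alpha> m) * emeasure lborel (level m))
      \<le> sequential_work (js ! \<pi> j)" if j: "j < n" for j
  proof -
    let ?K = "{k. k < length (js ! \<pi> j) \<and> parallelism (js ! \<pi> j ! k) = 1}"
    have \<pi>n: "\<pi> j < n" using \<pi>(1) j by (auto simp: bij_betw_def)
    have act: "\<pi> j \<in> A t \<longleftrightarrow> j < card (A t)" for t
      using \<pi>(2)[OF j, of "ennreal t"] \<pi>n by (simp add: active_jobs_def active_def)
    have "(\<Sum>m\<in>{Suc j..min n P}. ennreal (p_first_speed \<alpha> m) * emeasure lborel (level m))
      = (\<integral>\<^sup>+t. (\<Sum>m\<in>{Suc j..min n P}. ennreal (p_first_speed \<alpha> m) * indicator (level m) t) \<partial>lborel)"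
      by (subst nn_integral_sum) (auto simp: nn_integral_cmult_indicator)
    also have "\<dots> \<le> (\<integral>\<^sup>+t. (\<Sum>k\<in>?K. ennreal (rate (\<pi> j) (parallelism (js ! \<pi> j ! k)) t)
        * indicator (ptime (\<pi> j) k) t) \<partial>lborel)"
    proof (rule nn_integral_mono)
      fix t :: real
      show "(\<Sum>m\<in>{Suc j..min n P}. ennreal (p_first_speed \<alpha> m) * indicator (level m) t)
        \<le> (\<Sum>k\<in>?K. ennreal (rate (\<pi> j) (parallelism (js ! \<pi> j ! k)) t) * indicator (ptime (\<pi> j) k) t)"
      proof (cases "\<exists>m\<in>{Suc j..min n P}. t \<in> level m")
        case True
        then obtain m where m: "m \<in> {Suc j..min n P}" "t \<in> level m" by blast
        \<comment> \<open>The levels are disjoint, so only one term of the sum survives.\<close>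
        then have "indicator (level l) t = (if l = m then 1 else 0 :: ennreal)" for l
          by (auto simp: level_def)
        then have "(\<Sum>m\<in>{Suc j..min n P}. ennreal (p_first_speed \<alpha> m) * indicator (level m) t)
            = (\<Sum>l\<in>{Suc j..min n P}. if l = m then ennreal (p_first_speed \<alpha> m) else 0)"
          by (intro sum.cong) auto
        also have "\<dots> = ennreal (p_first_speed \<alpha> m)" using m by simp
        finally show ?thesis
          using level_rate[of "\<pi> j" t m] m act[of t] by (auto simp: level_def)
      next
        case False
        then have "(\<Sum>m\<in>{Suc j..min n P}. ennreal (p_first_speed \<alpha> m) * indicator (level m) t) = 0"
          by (intro sum.neutral) auto
        then show ?thesis by simp
      qed
    qed
    also have "\<dots> \<le> sequential_work (js ! \<pi> j)"
      unfolding sequential_work_def using \<pi>n by (intro integral_phases_le_work) auto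
    finally show ?thesis .
  qed
  with \<pi>(1) that show ?thesis by blast
qed

lemma emeasure_busy_le:
  "emeasure lborel busy \<le> emeasure lborel full_load + (\<Sum>m\<in>{1..min n P}. emeasure lborel (level m))"
proof -
  have "emeasure lborel busy \<le> emeasure lborel (full_load \<union> (\<Union>m\<in>{1..min n P}. level m))"
    using busy_subset by (intro emeasure_mono) auto
  also have "\<dots> \<le> emeasure lborel full_load + emeasure lborel (\<Union>m\<in>{1..min n P}. level m)"
    by (intro emeasure_subadditive) auto
  also have "emeasure lborel (\<Union>m\<in>{1..min n P}. level m) \<le> (\<Sum>m\<in>{1..min n P}. emeasure lborel (level m))"
    by (intro emeasure_subadditive_finite) auto
  finally show ?thesis by simp
qed

end

section \<open>Competitiveness\<close>

lemma harm_le_ln: "0 < m \<Longrightarrow> harm m \<le> 1 + ln (real m)"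
proof -
  assume "0 < m"
  then obtain k where k: "m = Suc k" by (cases m) auto
  have "harm (Suc k) - ln (real (Suc k)) \<le> harm (Suc 0) - ln (real (Suc 0))"
    using decseq_harm_diff_ln by (rule decseqD) simp
  then show ?thesis using k by (simp add: harm_def)
qed

text \<open>This keeps \<open>ln P\<close> away from 0, so that additive constants can be absorbed
  into multiples of it.\<close>

lemma ln_ge_half:
  fixes x :: real
  assumes "2 \<le> x"
  shows "1 / 2 \<le> ln x"
proof -
  have "ln (1 / x) \<le> 1 / x - 1" using assms by (intro ln_le_minus_one) simp
  moreover have "1 / x \<le> 1 / 2" using assms by (simp add: field_simps)
  moreover have "ln (1 / x) = - ln x" using assms by (simp add: ln_div)
  ultimately show ?thesis by linarith
qed

text \<open>The left side is \<open>m\<close> copies of \<open>m powr (\<beta> - 1)\<close>, the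
  smallest term of the sum. With \<open>\<beta> = 1 / \<alpha>\<close> the reciprocal speed of a
  level is spread over the ranks of the active jobs.\<close>

lemma powr_le_sum_powr:
  fixes \<beta> :: real
  assumes "\<beta> \<le> 1"
  shows "real m powr \<beta> \<le> (\<Sum>j<m. real (Suc j) powr (\<beta> - 1))"
proof (cases "m = 0")
  case False
  have "real m powr \<beta> = real m * real m powr (\<beta> - 1)"
    using False by (simp add: powr_diff)
  also have "\<dots> = (\<Sum>j<m. real m powr (\<beta> - 1))" by simp
  also have "\<dots> \<le> (\<Sum>j<m. real (Suc j) powr (\<beta> - 1))"
    using assms by (intro sum_mono powr_mono2') auto
  finally show ?thesis .
qed simp

lemma sum_triangle_swap:
  fixes f :: "nat \<Rightarrow> nat \<Rightarrow> 'a::comm_monoid_add"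
  shows "(\<Sum>m\<in>{1..N}. \<Sum>j<m. f j m) = (\<Sum>j<N. \<Sum>m\<in>{Suc j..N}. f j m)"
  by (simp add: sum.Sigma) (rule sum.reindex_bij_witness[of _ prod.swap prod.swap], auto)

section \<open>Comparison with an arbitrary schedule\<close>

lemma (in p_first_execution) full_load_time_le:
  assumes valid: "valid_schedule P js \<sigma>" and energy: "energy (sched_power \<alpha> P \<sigma>) < \<infinity>"
  shows "emeasure lborel full_load \<le> ennreal ((\<alpha> - 1) powr (1 / \<alpha>)) * sched_cost \<alpha> P js \<sigma>"
proof -
  let ?M = "makespan (sched_rate \<sigma>) js" and ?E = "energy (sched_power \<alpha> P \<sigma>)"
  define \<kappa> where "\<kappa> = (\<alpha> - 1) powr (1 / \<alpha>)"
  \<comment> \<open>This \<open>c\<close> gives time and energy the same weight: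
    \<open>c * P\<close> and \<open>c powr (1 - \<alpha>)\<close> both equal
    \<open>w\<close>.\<close>
  define c where "c = real P powr (- (1 / \<alpha>))"
  define w where "w = real P powr (1 - 1 / \<alpha>)"
  have P0: "real P > 0" using P by simp
  have pos: "\<kappa> \<ge> 0" "c > 0" "w > 0" using P0 by (auto simp: \<kappa>_def c_def w_def)
  have cP: "c * real P = w"
    using P0 unfolding c_def w_def by (simp add: powr_diff powr_minus field_simps)
  have "- (1 / \<alpha>) * (1 - \<alpha>) = 1 - 1 / \<alpha>" using alpha by (simp add: field_simps)
  then have cw: "c powr (1 - \<alpha>) = w" unfolding c_def w_def powr_powr by simp
  \<comment> \<open>The total rate under full load is \<open>w / \<kappa>\<close>, so
    \<open>w\<close> cancels in the end.\<close>
  have "\<kappa> * (real P * p_first_speed \<alpha> P) = w * (\<kappa> * real P powr (1 / \<alpha>) * p_first_speed \<alpha> P)"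
    using P0 by (simp add: w_def powr_diff)
  then have one: "\<kappa> / w * (real P * p_first_speed \<alpha> P) = 1"
    using p_first_speed_mult[OF alpha, of P] P pos by (simp add: \<kappa>_def)
  have speed: "0 \<le> real P * p_first_speed \<alpha> P"
    using p_first_speed_pos[OF alpha, of P] P by simp
  have "emeasure lborel full_load = ennreal (\<kappa> / w * (real P * p_first_speed \<alpha> P)) * emeasure lborel full_load"
    unfolding one by simp
  also have "\<dots> = ennreal (\<kappa> / w) * (ennreal (real P * p_first_speed \<alpha> P) * emeasure lborel full_load)"
    using pos speed by (subst ennreal_mult) (auto simp: mult_ac)
  also have "\<dots> \<le> ennreal (\<kappa> / w) * (\<Sum>i<n. total_work (js ! i))"
    by (intro mult_left_mono full_load_time) simp
  also have "\<dots> \<le> ennreal (\<kappa> / w) * (ennreal w * ?M + ennreal w * ?E)"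
    using sum_total_work_le[OF valid _ energy alpha pos(2)] jobs by (intro mult_left_mono) (auto simp: cP cw)
  also have "\<dots> = ennreal \<kappa> * (?M + ?E)"
    using pos by (simp add: ennreal_mult[symmetric] mult.assoc[symmetric] flip: distrib_left)
  finally show ?thesis by (simp add: \<kappa>_def sched_cost_def)
qed

lemma (in p_first_execution) level_time_le:
  assumes valid: "valid_schedule P js \<sigma>" and energy: "energy (sched_power \<alpha> P \<sigma>) < \<infinity>"
  shows "(\<Sum>m\<in>{1..min n P}. emeasure lborel (level m))
    \<le> ennreal (3 * (\<alpha> - 1) powr (1 / \<alpha>) * ln (real P) powr (1 - 1 / \<alpha>)) * sched_cost \<alpha> P js \<sigma>"
proof -
  let ?M = "makespan (sched_rate \<sigma>) js" and ?E = "energy (sched_power \<alpha> P \<sigma>)"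
  let ?Ej = "\<lambda>i. energy (job_power \<alpha> P \<sigma> i)"
  define \<kappa> where "\<kappa> = (\<alpha> - 1) powr (1 / \<alpha>)"
  define l where "l = ln (real P)"
  define v where "v = l powr (1 - 1 / \<alpha>)"
  define \<theta> where "\<theta> = l powr (- (1 / \<alpha>))"
  define N where "N = min n P"
  define b where "b j = real (Suc j) powr (1 / \<alpha> - 1)" for j :: nat
  \<comment> \<open>This threshold for the job of rank \<open>j\<close> makes the energy weight
    \<open>b j * c j powr (1 - \<alpha>)\<close> equal to \<open>v\<close> for every rank and the
    makespan weight \<open>b j * c j\<close> equal to \<open>\<theta>\<close> times a harmonic term.
    The factor \<open>\<theta>\<close> balances the two: the harmonic sum is at most of order
    \<open>l\<close>, and \<open>\<theta> * l = v\<close>.\<close>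
  define c where "c j = \<theta> * real (Suc j) powr (- (1 / \<alpha>))" for j :: nat
  define y where "y m = ennreal (p_first_speed \<alpha> m) * emeasure lborel (level m)" for m
  have l: "1 / 2 \<le> l" unfolding l_def using P by (intro ln_ge_half) simp
  have pos: "\<kappa> \<ge> 0" "v > 0" "\<theta> > 0" "\<And>j. b j > 0" "\<And>j. c j > 0"
    using l by (auto simp: \<kappa>_def v_def \<theta>_def b_def c_def)
  have \<theta>l: "\<theta> * l = v"
    using l unfolding v_def \<theta>_def by (simp add: powr_diff powr_minus field_simps)
  have exps: "- (1 / \<alpha>) * (1 - \<alpha>) = 1 - 1 / \<alpha>" using alpha by (simp add: field_simps)
  have \<theta>v: "\<theta> powr (1 - \<alpha>) = v" unfolding v_def \<theta>_def powr_powr exps ..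
  have bc: "b j * c j = \<theta> / real (Suc j)" for j
  proof -
    have "b j * c j = \<theta> * real (Suc j) powr (1 / \<alpha> - 1 + (- (1 / \<alpha>)))"
      by (simp only: b_def c_def powr_add mult_ac)
    then show ?thesis by (simp add: powr_minus field_simps)
  qed
  have bc': "b j * c j powr (1 - \<alpha>) = v" for j
  proof -
    have "c j powr (1 - \<alpha>) = v * real (Suc j) powr (1 - 1 / \<alpha>)"
      unfolding c_def powr_mult \<theta>v powr_powr exps ..
    then have "b j * c j powr (1 - \<alpha>) = v * real (Suc j) powr (1 / \<alpha> - 1 + (1 - 1 / \<alpha>))"
      by (simp only: b_def powr_add mult_ac)
    then show ?thesis by simp
  qed
  obtain \<pi> where \<pi>: "bij_betw \<pi> {..<n} {..<n}"
    "\<And>j. j < n \<Longrightarrow> (\<Sum>m\<in>{Suc j..N}. y m) \<le> sequential_work (js ! \<pi> j)"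
    using level_time unfolding N_def y_def by metis
  have "(\<Sum>m\<in>{1..N}. emeasure lborel (level m)) \<le> (\<Sum>m\<in>{1..N}. ennreal \<kappa> * (\<Sum>j<m. ennreal (b j) * y m))"
  proof (rule sum_mono)
    fix m assume "m \<in> {1..N}"
    then have m: "0 < m" by simp
    have r: "0 \<le> p_first_speed \<alpha> m" using p_first_speed_pos[OF alpha m] by simp
    \<comment> \<open>The factor 1 is rewritten with the speed of the level, and
      \<open>m powr (1 / \<alpha>)\<close> is split over the ranks below \<open>m\<close>.\<close>
    have "1 = \<kappa> * real m powr (1 / \<alpha>) * p_first_speed \<alpha> m"
      using p_first_speed_mult[OF alpha m] by (simp add: \<kappa>_def)
    also have "\<dots> \<le> \<kappa> * (\<Sum>j<m. b j) * p_first_speed \<alpha> m"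
      unfolding b_def using powr_le_sum_powr[of "1 / \<alpha>" m] alpha pos(1) r
      by (intro mult_right_mono mult_left_mono) auto
    finally have "ennreal 1 \<le> ennreal (\<kappa> * (\<Sum>j<m. b j) * p_first_speed \<alpha> m)"
      by (rule ennreal_leI)
    also have "\<dots> = ennreal \<kappa> * ennreal (\<Sum>j<m. b j) * ennreal (p_first_speed \<alpha> m)"
      using pos r by (simp add: ennreal_mult sum_nonneg less_imp_le)
    also have "ennreal (\<Sum>j<m. b j) = (\<Sum>j<m. ennreal (b j))"
      using pos by (simp add: less_imp_le)
    finally have "1 * emeasure lborel (level m)
        \<le> ennreal \<kappa> * (\<Sum>j<m. ennreal (b j)) * ennreal (p_first_speed \<alpha> m) * emeasure lborel (level m)"
      by (intro mult_right_mono) auto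
    then show "emeasure lborel (level m) \<le> ennreal \<kappa> * (\<Sum>j<m. ennreal (b j) * y m)"
      unfolding y_def sum_distrib_right[symmetric] by (simp only: mult.assoc mult_1)
  qed
  \<comment> \<open>Exchanging the sums collects, for each rank, the levels at which that job runs;
    its sequential work bounds them.\<close>
  also have "\<dots> = ennreal \<kappa> * (\<Sum>j<N. ennreal (b j) * (\<Sum>m\<in>{Suc j..N}. y m))"
    unfolding sum_distrib_left[symmetric] sum_triangle_swap ..
  also have "\<dots> \<le> ennreal \<kappa> * (\<Sum>j<N. ennreal (b j) *
      (ennreal (c j) * ?M + ennreal (c j powr (1 - \<alpha>)) * ?Ej (\<pi> j)))"
  proof (intro mult_left_mono sum_mono)
    fix j assume "j \<in> {..<N}"
    then have j: "j < n" by (simp add: N_def)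
    then have "\<pi> j < n" using \<pi>(1) by (auto simp: bij_betw_def)
    then show "(\<Sum>m\<in>{Suc j..N}. y m) \<le> ennreal (c j) * ?M + ennreal (c j powr (1 - \<alpha>)) * ?Ej (\<pi> j)"
      using \<pi>(2)[OF j] sequential_work_le[OF valid _ energy alpha pos(5)] by (meson order_trans)
  qed auto
  also have "\<dots> = ennreal \<kappa> * ((\<Sum>j<N. ennreal (\<theta> / real (Suc j))) * ?M + ennreal v * (\<Sum>j<N. ?Ej (\<pi> j)))"
  proof -
    have "ennreal (b j) * (ennreal (c j) * ?M + ennreal (c j powr (1 - \<alpha>)) * ?Ej (\<pi> j))
        = ennreal (\<theta> / real (Suc j)) * ?M + ennreal v * ?Ej (\<pi> j)" for j
      unfolding bc[symmetric] bc'[of j, symmetric] using pos(4,5)[of j]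
      by (simp add: ennreal_mult distrib_left mult.assoc)
    then show ?thesis by (simp only: sum.distrib sum_distrib_left sum_distrib_right)
  qed
  also have "\<dots> \<le> ennreal \<kappa> * (ennreal (3 * v) * ?M + ennreal (3 * v) * ?E)"
  proof (intro mult_left_mono add_mono mult_mono)
    have "(\<Sum>j<N. \<theta> / real (Suc j)) = \<theta> * harm N"
      by (simp add: harm_altdef sum_distrib_left divide_inverse)
    also have "\<dots> \<le> \<theta> * (3 * l)"
    proof (rule mult_left_mono)
      have "harm N \<le> (harm P :: real)" by (rule harm_mono) (simp add: N_def)
      also have "\<dots> \<le> 1 + l" unfolding l_def using P by (intro harm_le_ln) simp
      \<comment> \<open>Source of the factor 3: \<open>1 \<le> 2 * l\<close>, because
        \<open>l\<close> is at least 1/2.\<close>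
      also have "\<dots> \<le> 3 * l" using l by simp
      finally show "harm N \<le> 3 * l" .
    qed (use pos in simp)
    also have "\<dots> = 3 * v" using \<theta>l by simp
    finally show "(\<Sum>j<N. ennreal (\<theta> / real (Suc j))) \<le> ennreal (3 * v)"
      using pos by (subst sum_ennreal) (auto intro!: ennreal_leI simp: less_imp_le)
    have "(\<Sum>j<N. ?Ej (\<pi> j)) \<le> (\<Sum>j<n. ?Ej (\<pi> j))"
      by (intro sum_mono2) (auto simp: N_def)
    also have "\<dots> = (\<Sum>i<n. ?Ej i)" by (rule sum.reindex_bij_betw[OF \<pi>(1)])
    also have "\<dots> \<le> ?E" by (rule sum_energy_job_power_le[OF valid])
    finally show "(\<Sum>j<N. ?Ej (\<pi> j)) \<le> ?E" .
  qed (use pos in \<open>auto intro!: ennreal_leI\<close>)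
  also have "\<dots> = ennreal (3 * \<kappa> * v) * (?M + ?E)"
    using pos by (simp add: ennreal_mult distrib_left mult_ac)
  finally show ?thesis by (simp add: \<kappa>_def v_def l_def N_def sched_cost_def)
qed

lemma (in p_first_execution) shared_cost_le:
  assumes valid: "valid_schedule P js \<sigma>"
  shows "shared_cost \<alpha> js a s \<le>
    ennreal (5 * (\<alpha> - 1) powr (1 / \<alpha>) * (\<alpha> / (\<alpha> - 1)) * ln (real P) powr (1 - 1 / \<alpha>)) * sched_cost \<alpha> P js \<sigma>"
proof -
  define \<kappa> where "\<kappa> = (\<alpha> - 1) powr (1 / \<alpha>)"
  define v where "v = ln (real P) powr (1 - 1 / \<alpha>)"
  have \<kappa>: "\<kappa> > 0" using alpha by (simp add: \<kappa>_def)
  have l: "1 / 2 \<le> ln (real P)" using P by (intro ln_ge_half) simp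
  \<comment> \<open>Once \<open>v\<close> is at least 1/2, the part \<open>\<kappa>\<close> from
    full load is at most \<open>2 * \<kappa> * v\<close>, which raises the coefficient 3 of the
    levels to 5.\<close>
  have "1 / 2 = (1 / 2 :: real) powr 1" by simp
  also have "\<dots> \<le> (1 / 2) powr (1 - 1 / \<alpha>)" using alpha by (intro powr_mono') auto
  also have "\<dots> \<le> v" unfolding v_def using alpha l by (intro powr_mono2) auto
  finally have v: "1 / 2 \<le> v" .
  show ?thesis
  proof (cases "energy (sched_power \<alpha> P \<sigma>) < \<infinity>")
    case True
    have "emeasure lborel busy \<le> ennreal \<kappa> * sched_cost \<alpha> P js \<sigma> + ennreal (3 * \<kappa> * v) * sched_cost \<alpha> P js \<sigma>"
      using emeasure_busy_le full_load_time_le[OF valid True] level_time_le[OF valid True]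
      unfolding \<kappa>_def v_def by (meson add_mono order_trans)
    also have "\<dots> = ennreal (\<kappa> + 3 * \<kappa> * v) * sched_cost \<alpha> P js \<sigma>"
      using \<kappa> v by (simp add: distrib_right)
    also have "\<dots> \<le> ennreal (5 * \<kappa> * v) * sched_cost \<alpha> P js \<sigma>"
      using \<kappa> v by (intro mult_right_mono ennreal_leI) auto
    finally have "ennreal (\<alpha> / (\<alpha> - 1)) * emeasure lborel busy
        \<le> ennreal (\<alpha> / (\<alpha> - 1)) * (ennreal (5 * \<kappa> * v) * sched_cost \<alpha> P js \<sigma>)"
      by (rule mult_left_mono) simp
    also have "\<dots> = ennreal (5 * \<kappa> * (\<alpha> / (\<alpha> - 1)) * v) * sched_cost \<alpha> P js \<sigma>"
      using \<kappa> v alpha by (simp add: ennreal_mult[symmetric] mult.assoc[symmetric]) (simp add: mult_ac)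
    finally show ?thesis by (simp add: shared_cost_eq \<kappa>_def v_def)
  next
    case False
    \<comment> \<open>Infinite energy makes the right side infinite, its coefficient being
      positive.\<close>
    then have "sched_cost \<alpha> P js \<sigma> = \<infinity>" by (simp add: sched_cost_def not_less top_unique)
    moreover have "5 * \<kappa> * (\<alpha> / (\<alpha> - 1)) * v > 0" using \<kappa> v alpha by simp
    ultimately have "ennreal (5 * \<kappa> * (\<alpha> / (\<alpha> - 1)) * v) * sched_cost \<alpha> P js \<sigma> = \<infinity>"
      by (simp only: ennreal_mult_top ennreal_eq_0_iff not_le infinity_ennreal_def simp_thms if_False if_True flip: not_less)
    then show ?thesis by (simp add: \<kappa>_def v_def)
  qed
qed

text \<open>Multiplying by \<open>1 / K\<close> moves the constant to the other side, where the
  infimum is the greatest lower bound.\<close>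

lemma le_mult_INF_ennreal:
  fixes f :: "'a \<Rightarrow> ennreal"
  assumes "0 < K" "\<And>x. x \<in> X \<Longrightarrow> z \<le> ennreal K * f x"
  shows "z \<le> ennreal K * (INF x\<in>X. f x)"
proof -
  have one: "ennreal K * ennreal (1 / K) = 1" using assms(1) by (simp flip: ennreal_mult)
  have "ennreal (1 / K) * z \<le> (INF x\<in>X. f x)"
  proof (rule INF_greatest)
    fix x assume "x \<in> X"
    then have "ennreal (1 / K) * z \<le> ennreal (1 / K) * (ennreal K * f x)"
      by (intro mult_left_mono assms) auto
    then show "ennreal (1 / K) * z \<le> f x"
      using one by (simp add: mult.assoc[symmetric] mult.commute[of "ennreal (1 / K)"])
  qed
  then have "ennreal K * (ennreal (1 / K) * z) \<le> ennreal K * (INF x\<in>X. f x)"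
    by (rule mult_left_mono) simp
  then show ?thesis using one by (simp add: mult.assoc[symmetric])
qed

theorem theorem10:
  fixes \<alpha> :: real
  assumes "\<alpha> > 1"
  shows "\<exists>C>0. \<forall>P::nat. \<forall>js :: job list. \<forall>a :: nat \<Rightarrow> real \<Rightarrow> real. \<forall>s :: real \<Rightarrow> real.
           P \<ge> 2 \<longrightarrow> (\<forall>J\<in>set js. wf_job J \<and> par_seq J) \<longrightarrow> p_first \<alpha> P js a s \<longrightarrow>
             shared_cost \<alpha> js a s
               \<le> ennreal (C * ln (real P) powr (1 - 1 / \<alpha>)) * opt_cost \<alpha> P js"
proof (intro exI[of _ "5 * (\<alpha> - 1) powr (1 / \<alpha>) * (\<alpha> / (\<alpha> - 1))"] conjI allI impI)
  \<comment> \<open>The factor 5 and the power of \<open>\<alpha> - 1\<close> come from the bound on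
    the busy time, \<open>\<alpha> / (\<alpha> - 1)\<close> from turning busy time into makespan
    plus energy.\<close>
  show "0 < 5 * (\<alpha> - 1) powr (1 / \<alpha>) * (\<alpha> / (\<alpha> - 1))" using assms by simp
next
  fix P :: nat and js :: "job list" and a :: "nat \<Rightarrow> real \<Rightarrow> real" and s :: "real \<Rightarrow> real"
  assume *: "2 \<le> P" "\<forall>J\<in>set js. wf_job J \<and> par_seq J" "p_first \<alpha> P js a s"
  interpret p_first_execution \<alpha> P js a s
    using assms * by unfold_locales auto
  show "shared_cost \<alpha> js a s \<le> ennreal (5 * (\<alpha> - 1) powr (1 / \<alpha>) * (\<alpha> / (\<alpha> - 1))
      * ln (real P) powr (1 - 1 / \<alpha>)) * opt_cost \<alpha> P js"
    unfolding opt_cost_def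
    using shared_cost_le assms *(1) by (intro le_mult_INF_ennreal) auto
qed

end
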